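(* (a) Let $T$ be a rooted tree such that the forest $T'$ is a collection of cyclotomic trees and $\nu(T')>2$. Then $T$ is a Salem tree. (If instead $\nu(T')\le2$, then $T$ is a cyclotomic tree.) (b) Let $T_1$ and $T_2$ be rooted trees each of the type in (a) (i.e. $T_i'$ is a collection of cyclotomic trees and $\nu(T_i')>2$), with $(\nu(T_1')-2)(\nu(T_2')-2)\le1$. Then $T_1+T_2$ is a Salem tree. (If $(\nu(T_1')-2)(\nu(T_2')-2)>1$, then the reciprocal polynomial of $T_1+T_2$ has two roots outside the unit circle.) (c) Every Salem tree is, for a suitable choice of root, of the type in (a), or is of the form $T_1+T_2$ as in (b).
   Context: Graphs are finite simple graphs; eigenvalues are those of the adjacency matrix. A graph is cyclotomic if all its eigenvalues lie in $[-2,2]$. A bipartite graph (in particular a tree) is a Salem graph if it has exactly one eigenvalue $\lambda>2$ and only the eigenvalue $-\lambda$ in $(-\infty,-2)$; a Salem tree is a tree that is a Salem graph. For a tree $T$ on $n$ vertices with characteristic polynomial $\chi_T$, $R_T(z)=z^{n/2}\chi_T(\sqrt z+1/\sqrt z)$. A rooted tree has a distinguished vertex $r$; $T'$ is the rooted forest $T-\{r\}$, each component rooted at the vertex adjacent to $r$. The quotient of a rooted tree is $q_T=\prod_iR_{T_i}(z)/R_T(z)$ over the trees $T_i$ of $T'$; the quotient of a rooted forest is the sum of the quotients of its trees. The $\nu$-value of a rooted tree is $\nu(T)=q_T(1)$, with $\nu(T)=\infty$ if $q_T$ has a pole at $1$; for a forest, $\nu$ is the sum of the $\nu$-values of its trees.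 For rooted trees $T_1,T_2$, $T_1+T_2$ is the rooted tree obtained by joining their roots by an edge, rooted at the root of $T_1$. *)

theory Defs
  imports Complex_Main "HOL-Combinatorics.Permutations"
    "HOL-Computational_Algebra.Polynomial" "HOL-Library.Extended_Real"
begin

text \<open>A finite simple graph is given by a finite vertex set V together with an
  ambient relation E; the graph is the one induced by E on V (only E restricted
  to V matters).\<close>

definition adj_on :: "'a set \<Rightarrow> ('a \<Rightarrow> 'a \<Rightarrow> bool) \<Rightarrow> 'a \<Rightarrow> 'a \<Rightarrow> bool" where
  "adj_on V E u v \<longleftrightarrow> u \<in> V \<and> v \<in> V \<and> E u v"

definition is_tree :: "'a set \<Rightarrow> ('a \<Rightarrow> 'a \<Rightarrow> bool) \<Rightarrow> bool" where
  "is_tree V E \<longleftrightarrow> finite V \<and> V \<noteq> {}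
     \<and> (\<forall>u\<in>V. \<not> E u u) \<and> (\<forall>u\<in>V. \<forall>v\<in>V. E u v \<longrightarrow> E v u)
     \<and> (\<forall>u\<in>V. \<forall>v\<in>V. (adj_on V E)\<^sup>*\<^sup>* u v)
     \<and> card {(u, v). adj_on V E u v} = 2 * (card V - 1)"

text \<open>Characteristic polynomial det(xI - A) of the adjacency matrix, written
  out via the Leibniz formula over permutations of the vertex set.\<close>

definition charpoly :: "'a set \<Rightarrow> ('a \<Rightarrow> 'a \<Rightarrow> bool) \<Rightarrow> real poly" where
  "charpoly V E = (\<Sum>p | p permutes V. of_int (sign p) *
      (\<Prod>v\<in>V. (if p v = v then [:0, 1:] else 0) - (if E v (p v) then 1 else 0)))"

definition is_eigenvalue :: "'a set \<Rightarrow> ('a \<Rightarrow> 'a \<Rightarrow> bool) \<Rightarrow> real \<Rightarrow> bool" where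
  "is_eigenvalue V E x \<longleftrightarrow> poly (charpoly V E) x = 0"

definition cyclotomic :: "'a set \<Rightarrow> ('a \<Rightarrow> 'a \<Rightarrow> bool) \<Rightarrow> bool" where
  "cyclotomic V E \<longleftrightarrow> (\<forall>x. is_eigenvalue V E x \<longrightarrow> -2 \<le> x \<and> x \<le> 2)"

definition bipartite :: "'a set \<Rightarrow> ('a \<Rightarrow> 'a \<Rightarrow> bool) \<Rightarrow> bool" where
  "bipartite V E \<longleftrightarrow> (\<exists>A\<subseteq>V. \<forall>u\<in>V. \<forall>v\<in>V. E u v \<longrightarrow> (u \<in> A \<longleftrightarrow> v \<notin> A))"

definition salem_graph :: "'a set \<Rightarrow> ('a \<Rightarrow> 'a \<Rightarrow> bool) \<Rightarrow> bool" where
  "salem_graph V E \<longleftrightarrow> bipartite V E \<and>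
     (\<exists>l>2. is_eigenvalue V E l \<and> order l (charpoly V E) = 1
        \<and> (\<forall>x. is_eigenvalue V E x \<and> x > 2 \<longrightarrow> x = l)
        \<and> (\<forall>x. is_eigenvalue V E x \<and> x < -2 \<longrightarrow> x = -l))"

definition salem_tree :: "'a set \<Rightarrow> ('a \<Rightarrow> 'a \<Rightarrow> bool) \<Rightarrow> bool" where
  "salem_tree V E \<longleftrightarrow> is_tree V E \<and> salem_graph V E"

definition cyclotomic_tree :: "'a set \<Rightarrow> ('a \<Rightarrow> 'a \<Rightarrow> bool) \<Rightarrow> bool" where
  "cyclotomic_tree V E \<longleftrightarrow> is_tree V E \<and> cyclotomic V E"

text \<open>R_T(z) = z^(n/2) \<chi>_T(sqrt z + 1/sqrt z). Since z^(n/2) (sqrt z + 1/sqrt z)^k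
  = z^((n-k)/2) (z+1)^k, and for a tree (bipartite) only coefficients of \<chi>_T
  with k \<equiv> n (mod 2) are non-zero, this is the following polynomial.\<close>

definition Rpoly :: "'a set \<Rightarrow> ('a \<Rightarrow> 'a \<Rightarrow> bool) \<Rightarrow> real poly" where
  "Rpoly V E = (let n = card V; \<chi> = charpoly V E in
     (\<Sum>k\<le>n. if even (n - k)
               then smult (coeff \<chi> k) ([:1, 1:] ^ k * monom 1 ((n - k) div 2))
               else 0))"

definition root_children :: "'a set \<Rightarrow> ('a \<Rightarrow> 'a \<Rightarrow> bool) \<Rightarrow> 'a \<Rightarrow> 'a set" where
  "root_children V E r = {c \<in> V. E r c}"

definition branch :: "'a set \<Rightarrow> ('a \<Rightarrow> 'a \<Rightarrow> bool) \<Rightarrow> 'a \<Rightarrow> 'a \<Rightarrow> 'a set" where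
  "branch V E r c = {v. (adj_on (V - {r}) E)\<^sup>*\<^sup>* c v}"

text \<open>Numerator of the quotient q_T = \<Prod> R_{T_i} / R_T.\<close>

definition quot_num :: "'a set \<Rightarrow> ('a \<Rightarrow> 'a \<Rightarrow> bool) \<Rightarrow> 'a \<Rightarrow> real poly" where
  "quot_num V E r = (\<Prod>c\<in>root_children V E r. Rpoly (branch V E r c) E)"

text \<open>\<nu>(T) = q_T(1), or \<infinity> if q_T has a pole at 1 (value of the rational function
  at 1 after cancelling common factors z - 1).\<close>

definition nu_tree :: "'a set \<Rightarrow> ('a \<Rightarrow> 'a \<Rightarrow> bool) \<Rightarrow> 'a \<Rightarrow> ereal" where
  "nu_tree V E r = (let P = quot_num V E r; Q = Rpoly V E; m = order 1 Q in
     if order 1 P < m then PInfty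
     else ereal (poly (P div [:-1, 1:] ^ m) 1 / poly (Q div [:-1, 1:] ^ m) 1))"

definition nu_forest :: "'a set \<Rightarrow> ('a \<Rightarrow> 'a \<Rightarrow> bool) \<Rightarrow> 'a \<Rightarrow> ereal" where
  "nu_forest V E r = (\<Sum>c\<in>root_children V E r. nu_tree (branch V E r c) E c)"

definition typeA :: "'a set \<Rightarrow> ('a \<Rightarrow> 'a \<Rightarrow> bool) \<Rightarrow> 'a \<Rightarrow> bool" where
  "typeA V E r \<longleftrightarrow> is_tree V E \<and> r \<in> V
     \<and> (\<forall>c\<in>root_children V E r. cyclotomic_tree (branch V E r c) E)
     \<and> nu_forest V E r > 2"

definition plus_rel :: "'a set \<Rightarrow> ('a \<Rightarrow> 'a \<Rightarrow> bool) \<Rightarrow> 'a \<Rightarrow> 'a set \<Rightarrow> ('a \<Rightarrow> 'a \<Rightarrow> bool) \<Rightarrow> 'a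
    \<Rightarrow> 'a \<Rightarrow> 'a \<Rightarrow> bool" where
  "plus_rel V1 E1 r1 V2 E2 r2 u v \<longleftrightarrow> adj_on V1 E1 u v \<or> adj_on V2 E2 u v
     \<or> (u = r1 \<and> v = r2) \<or> (u = r2 \<and> v = r1)"

definition roots_outside :: "real poly \<Rightarrow> nat" where
  "roots_outside p = (\<Sum>z\<in>{z. poly (map_poly complex_of_real p) z = 0 \<and> cmod z > 1}.
                        order z (map_poly complex_of_real p))"

end

theory Submission
  imports Defs "HOL-Analysis.Extended_Real_Limits"
begin

text \<open>For a rooted tree \<open>T\<close> put \<open>f\<^sub>T = \<chi>\<^sub>T / \<chi>\<^sub>T\<^sub>'\<close>. Expanding \<open>\<chi>\<^sub>T\<close> at the root gives
  \<open>f\<^sub>T(x) = x - \<Sum> 1 / f\<^sub>T\<^sub>i(x)\<close>, summed over the branches, and a Wronskian computation shows that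
  \<open>f\<^sub>T\<close> is increasing away from its poles. If the branches are cyclotomic there are no poles above 2,
  and \<open>f\<^sub>T(x) \<rightarrow> 2 - \<nu>(T')\<close> as \<open>x \<rightarrow> 2+\<close>; so \<open>f\<^sub>T\<close> has exactly one zero above 2 if \<open>\<nu>(T') > 2\<close> and
  none otherwise. The eigenvalues of \<open>T\<^sub>1 + T\<^sub>2\<close> above 2 are the solutions of \<open>f\<^sub>T\<^sub>1 f\<^sub>T\<^sub>2 = 1\<close>. For the
  converse, the Wronskian also shows that at each vertex of a Salem tree at most one branch is not
  cyclotomic. A vertex with only cyclotomic branches is a root as in (a); if there is none, some edge
  is such that the non-cyclotomic branch at each of its ends contains the other end.\<close>

section \<open>Forests\<close>

text \<open>Reality, simplicity and interlacing of the zeros are all drawn from the expansion at a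
  vertex, by induction over induced subgraphs. Deleting a vertex destroys connectedness, so the
  working notion is \<open>forest\<close> rather than \<open>is_tree\<close>, and "cyclotomic"
  becomes \<open>pos_above V E 2\<close>: the spectrum of a forest is symmetric about 0, so only
  zeros above 2 matter, and positivity is inherited by subsets.

  The obstacle is that \<nu> is the value at z = 1 of a cancelled quotient of polynomials R, whereas
  monotonicity belongs to quotients of \<chi> in the variable x. With z = w^2 and x = w + 1/w these
  quotients differ only by the factor w, which tends to 1 as x tends to 2. So \<nu> is a one-sided
  limit, possibly infinite, and limits of sums and products are taken in \<open>ereal\<close>.

  The threshold 2 is the value of the term x at x = 2. The bound 1 on the product in (b) comes from
  the equation f_1 f_2 = 1, which expresses that the product of the two \<chi> equals the product of
  the \<chi> with roots deleted.\<close>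

definition edge_count :: "'a set \<Rightarrow> ('a \<Rightarrow> 'a \<Rightarrow> bool) \<Rightarrow> nat" where
  "edge_count V E = card {(u, v). adj_on V E u v}"

definition conn :: "'a set \<Rightarrow> ('a \<Rightarrow> 'a \<Rightarrow> bool) \<Rightarrow> bool" where
  "conn V E \<longleftrightarrow> (\<forall>u\<in>V. \<forall>v\<in>V. (adj_on V E)\<^sup>*\<^sup>* u v)"

definition simple_graph :: "'a set \<Rightarrow> ('a \<Rightarrow> 'a \<Rightarrow> bool) \<Rightarrow> bool" where
  "simple_graph V E \<longleftrightarrow> finite V \<and> (\<forall>u\<in>V. \<not> E u u) \<and> (\<forall>u\<in>V. \<forall>v\<in>V. E u v \<longrightarrow> E v u)"

text \<open>Acyclicity, expressed by counting so that it passes to subsets for free.\<close>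

definition forest :: "'a set \<Rightarrow> ('a \<Rightarrow> 'a \<Rightarrow> bool) \<Rightarrow> bool" where
  "forest V E \<longleftrightarrow> simple_graph V E
     \<and> (\<forall>S\<subseteq>V. S \<noteq> {} \<longrightarrow> edge_count S E \<le> 2 * (card S - 1))"

lemma is_tree_iff_edge_count:
  "is_tree V E \<longleftrightarrow> simple_graph V E \<and> V \<noteq> {} \<and> conn V E \<and> edge_count V E = 2 * (card V - 1)"
  by (auto simp: is_tree_def simple_graph_def conn_def edge_count_def)

lemma simple_graph_subset: "simple_graph V E \<Longrightarrow> S \<subseteq> V \<Longrightarrow> simple_graph S E"
  by (auto simp: simple_graph_def finite_subset)

lemma forest_subset: "forest V E \<Longrightarrow> S \<subseteq> V \<Longrightarrow> forest S E"
  unfolding forest_def by (meson simple_graph_subset subset_trans)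

lemma finite_edges: "finite V \<Longrightarrow> finite {(u, v). adj_on V E u v}"
  by (rule finite_subset[of _ "V \<times> V"]) (auto simp: adj_on_def)

lemma adj_on_mono:
  assumes "(adj_on V E)\<^sup>*\<^sup>* u v" "V \<subseteq> W"
  shows "(adj_on W E)\<^sup>*\<^sup>* u v"
  using assms(1)
proof (induction rule: rtranclp_induct)
  case (step y z)
  then have "adj_on W E y z" using assms(2) by (auto simp: adj_on_def)
  with step.IH show ?case by (rule rtranclp.rtrancl_into_rtrancl)
qed simp

lemma edge_count_insert:
  assumes "simple_graph (insert v S) E" "v \<notin> S"
  shows "edge_count (insert v S) E = edge_count S E + 2 * card {u \<in> S. E v u}"
proof -
  let ?N = "{u \<in> S. E v u}"
  have fin: "finite S" "finite ?N" using assms by (auto simp: simple_graph_def)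
  have nv: "\<not> E v v" and sym: "\<And>u. u \<in> S \<Longrightarrow> E u v \<longleftrightarrow> E v u"
    using assms(1) unfolding simple_graph_def by blast+
  have eq: "{(a, b). adj_on (insert v S) E a b}
      = {(a, b). adj_on S E a b} \<union> (Pair v ` ?N \<union> (\<lambda>u. (u, v)) ` ?N)"
    by (auto simp: adj_on_def nv sym)
  have c1: "card (Pair v ` ?N \<union> (\<lambda>u. (u, v)) ` ?N) = card ?N + card ?N"
    using fin assms(2) by (subst card_Un_disjoint) (auto simp: card_image inj_on_def)
  show ?thesis
    unfolding edge_count_def eq
    by (subst card_Un_disjoint) (use fin assms(2) c1 in \<open>auto simp: finite_edges adj_on_def\<close>)
qed

lemma conn_grow:
  assumes "conn V E" "S \<subseteq> V" "S \<noteq> {}" "S \<noteq> V"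
  obtains u v where "u \<in> S" "v \<in> V - S" "E u v"
proof -
  obtain a b where ab: "a \<in> S" "b \<in> V - S" using assms by blast
  have "(adj_on V E)\<^sup>*\<^sup>* a b" using assms ab by (auto simp: conn_def)
  moreover have "b \<in> S \<or> (\<exists>u\<in>S. \<exists>v\<in>V - S. E u v)" if "(adj_on V E)\<^sup>*\<^sup>* a b" for b
    using that
  proof (induction rule: rtranclp_induct)
    case (step y z)
    then have "y \<in> V" "z \<in> V" "E y z" by (auto simp: adj_on_def)
    then show ?case using step.IH by blast
  qed (use ab in blast)
  ultimately have "\<exists>u\<in>S. \<exists>v\<in>V - S. E u v" using ab(2) by blast
  then show ?thesis using that by blast
qed

text \<open>As long as S is not all of V, some edge leaves it. Adding the far end of that edge to S
  raises the count by at least 2, because \<open>edge_count\<close> counts ordered pairs.\<close>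

lemma edge_count_conn:
  assumes "simple_graph V E" "conn V E" "S \<subseteq> V" "S \<noteq> {}"
  shows "edge_count S E + 2 * (card V - card S) \<le> edge_count V E"
  using assms(3,4)
proof (induction "card V - card S" arbitrary: S)
  case 0
  have "finite V" using assms(1) by (simp add: simple_graph_def)
  then have "S = V" using card_seteq[of V S] 0 by simp
  then show ?case by simp
next
  case (Suc n)
  have fV: "finite V" using assms(1) by (simp add: simple_graph_def)
  then have fS: "finite S" using Suc.prems finite_subset by blast
  have "S \<noteq> V" using Suc.hyps by auto
  then obtain u v where uv: "u \<in> S" "v \<in> V - S" "E u v"
    using conn_grow[OF assms(2) Suc.prems] by blast
  have sg: "simple_graph (insert v S) E"
    using simple_graph_subset[OF assms(1)] uv Suc.prems by blast
  have "E v u" using sg uv by (auto simp: simple_graph_def)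
  then have "{u \<in> S. E v u} \<noteq> {}" using uv by blast
  then have pos: "card {u \<in> S. E v u} \<ge> 1"
    using fS by (simp add: Suc_le_eq card_gt_0_iff)
  have cI: "card (insert v S) = Suc (card S)" using fS uv by auto
  have "card (insert v S) \<le> card V" using fV uv Suc.prems by (intro card_mono) auto
  moreover have "edge_count (insert v S) E + 2 * (card V - card (insert v S)) \<le> edge_count V E"
    by (rule Suc.hyps(1)) (use Suc.hyps(2) cI uv Suc.prems in auto)
  ultimately show ?case
    using edge_count_insert[OF sg] uv pos cI by auto
qed

lemma edge_count_conn_ge:
  assumes "simple_graph V E" "conn V E" "V \<noteq> {}"
  shows "2 * (card V - 1) \<le> edge_count V E"
proof -
  obtain v where v: "v \<in> V" using assms(3) by blast
  have "{(a, b). adj_on {v} E a b} = {}" using assms(1) v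
    by (auto simp: adj_on_def simple_graph_def)
  then have "edge_count {v} E = 0" by (simp add: edge_count_def)
  then show ?thesis using edge_count_conn[OF assms(1,2), of "{v}"] v by auto
qed

text \<open>In a tree every vertex outside S accounts for at least 2 of the 2(card V - 1) ordered
  edges, which leaves at most 2(card S - 1) for S. Conversely, the forest bound for V itself meets
  the lower bound from connectedness.\<close>

lemma is_tree_iff_forest: "is_tree V E \<longleftrightarrow> forest V E \<and> conn V E \<and> V \<noteq> {}"
proof
  assume t: "is_tree V E"
  then have sg: "simple_graph V E" and c: "conn V E" and ec: "edge_count V E = 2 * (card V - 1)"
    and ne: "V \<noteq> {}" by (auto simp: is_tree_iff_edge_count)
  have fV: "finite V" using sg by (simp add: simple_graph_def)
  have "edge_count S E \<le> 2 * (card S - 1)" if S: "S \<subseteq> V" "S \<noteq> {}" for S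
  proof -
    have "card S \<le> card V" "card S > 0"
      using S fV by (auto simp: card_mono card_gt_0_iff finite_subset)
    then show ?thesis using edge_count_conn[OF sg c S] ec by linarith
  qed
  then show "forest V E \<and> conn V E \<and> V \<noteq> {}" using sg c ne by (auto simp: forest_def)
next
  assume "forest V E \<and> conn V E \<and> V \<noteq> {}"
  then show "is_tree V E"
    using edge_count_conn_ge[of V E] by (fastforce simp: forest_def is_tree_iff_edge_count)
qed

text \<open>The degrees sum to \<open>edge_count\<close>, which is less than 2 card V, so they
  cannot all be at least 2.\<close>

lemma forest_exists_leaf:
  assumes "forest V E" "V \<noteq> {}"
  obtains v where "v \<in> V" "card {u \<in> V. E v u} \<le> 1"
proof -
  have fin: "finite V" using assms by (simp add: forest_def simple_graph_def)
  have "edge_count V E = card (SIGMA v:V. {u \<in> V. E v u})"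
    unfolding edge_count_def by (rule arg_cong[of _ _ card]) (auto simp: adj_on_def)
  also have "\<dots> = (\<Sum>v\<in>V. card {u \<in> V. E v u})" using fin by simp
  finally have ec: "(\<Sum>v\<in>V. card {u \<in> V. E v u}) \<le> 2 * (card V - 1)"
    using assms unfolding forest_def by (metis subset_refl)
  have "\<exists>v\<in>V. card {u \<in> V. E v u} \<le> 1"
  proof (rule ccontr)
    assume "\<not> ?thesis"
    then have "(\<Sum>v\<in>V. 2) \<le> (\<Sum>v\<in>V. card {u \<in> V. E v u})" by (intro sum_mono) force
    then have "2 * card V \<le> 2 * (card V - 1)" using ec by simp
    moreover have "card V > 0" using fin assms by (simp add: card_gt_0_iff)
    ultimately show False by linarith
  qed
  then show ?thesis using that by blast
qed

text \<open>Remove a vertex of degree at most 1, colour the rest, and give the vertex the colour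
  opposite to that of its neighbour, if there is one.\<close>

lemma forest_bipartite: "forest V E \<Longrightarrow> bipartite V E"
proof (induction "card V" arbitrary: V)
  case 0
  then have "V = {}" by (simp add: forest_def simple_graph_def)
  then show ?case by (auto simp: bipartite_def)
next
  case (Suc n)
  have sg: "simple_graph V E" and fin: "finite V"
    using Suc.prems by (auto simp: forest_def simple_graph_def)
  obtain v where v: "v \<in> V" "card {u \<in> V. E v u} \<le> 1"
    using forest_exists_leaf[OF Suc.prems] Suc.hyps(2) by (metis Zero_not_Suc card.empty)
  have "bipartite (V - {v}) E"
    using Suc.hyps(2) v fin forest_subset[OF Suc.prems] by (intro Suc.hyps(1)) auto
  then obtain A where A: "A \<subseteq> V - {v}"
    "\<And>a b. a \<in> V - {v} \<Longrightarrow> b \<in> V - {v} \<Longrightarrow> E a b \<Longrightarrow> a \<in> A \<longleftrightarrow> b \<notin> A"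
    by (auto simp: bipartite_def)
  have nb: "a = b" if "a \<in> V" "E v a" "b \<in> V" "E v b" for a b
    using v(2) fin that by (auto simp: card_le_Suc0_iff_eq)
  define B where "B = (if \<exists>u\<in>V. E v u \<and> u \<notin> A then insert v A else A)"
  have vv: "\<not> E v v" and sym: "\<And>a b. a \<in> V \<Longrightarrow> b \<in> V \<Longrightarrow> E a b \<Longrightarrow> E b a"
    using sg v by (auto simp: simple_graph_def)
  have vB: "u \<in> V \<Longrightarrow> E v u \<Longrightarrow> v \<in> B \<longleftrightarrow> u \<notin> B" for u
    using nb A(1) vv unfolding B_def by auto
  have oB: "u \<noteq> v \<Longrightarrow> u \<in> B \<longleftrightarrow> u \<in> A" for u by (auto simp: B_def)
  have "a \<in> B \<longleftrightarrow> b \<notin> B" if "a \<in> V" "b \<in> V" "E a b" for a b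
  proof (cases "a = v \<or> b = v")
    case True
    then show ?thesis using vB that sym by blast
  next
    case False
    then show ?thesis using oB A(2) that by auto
  qed
  moreover have "B \<subseteq> V" using A v by (auto simp: B_def)
  ultimately show ?case unfolding bipartite_def by blast
qed

text \<open>The points not fixed by p o p form a set S that p maps into itself. On it the pairs (a,
  p a) and (p a, a) are 2 card S distinct ordered edges, too many for a forest: a longer cycle of p
  would be a cycle of the graph.\<close>

lemma forest_closed_walk_permutation:
  assumes "forest V E" "p permutes V" "\<And>v. v \<in> V \<Longrightarrow> p v = v \<or> E v (p v)"
  shows "p (p v) = v"
proof (rule ccontr)
  assume nv: "p (p v) \<noteq> v"
  define S where "S = {v. p (p v) \<noteq> v}"
  have inj: "inj p" using assms(2) by (rule permutes_inj)
  have SV: "S \<subseteq> V" using assms(2) unfolding S_def by (auto dest: permutes_not_in)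
  have fin: "finite V" and sym: "\<And>a b. a \<in> V \<Longrightarrow> b \<in> V \<Longrightarrow> E a b \<Longrightarrow> E b a"
    using assms by (auto simp: forest_def simple_graph_def)
  have fS: "finite S" using SV fin finite_subset by blast
  have pS: "p a \<in> S" if "a \<in> S" for a using that inj by (auto simp: S_def inj_eq)
  have pE: "E a (p a)" if "a \<in> S" for a using assms(3) that SV by (force simp: S_def)
  let ?A = "(\<lambda>a. (a, p a)) ` S" and ?B = "(\<lambda>a. (p a, a)) ` S"
  have "?A \<union> ?B \<subseteq> {(u, v). adj_on S E u v}"
  proof -
    have "adj_on S E a (p a)" "adj_on S E (p a) a" if "a \<in> S" for a
      using that pS[OF that] pE[OF that] SV sym[of a "p a"] by (auto simp: adj_on_def)
    then show ?thesis by auto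
  qed
  then have "card (?A \<union> ?B) \<le> edge_count S E"
    unfolding edge_count_def using finite_edges[OF fS] by (rule card_mono[rotated])
  moreover have "card (?A \<union> ?B) = card S + card S"
    using fS inj by (subst card_Un_disjoint) (auto simp: card_image inj_on_def S_def)
  moreover have "edge_count S E \<le> 2 * (card S - 1)" "card S > 0"
    using assms(1) SV nv fS by (auto simp: forest_def S_def card_gt_0_iff)
  ultimately show False by linarith
qed

section \<open>The characteristic polynomial of a forest\<close>

lemma charpoly_cong:
  assumes "\<And>u v. u \<in> V \<Longrightarrow> v \<in> V \<Longrightarrow> E u v \<longleftrightarrow> F u v"
  shows "charpoly V E = charpoly V F"
  unfolding charpoly_def
proof (intro sum.cong refl arg_cong2[where f = "(*)"] prod.cong)
  fix p v assume "p \<in> {p. p permutes V}" "v \<in> V"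
  then have "E v (p v) \<longleftrightarrow> F v (p v)" using assms by (auto simp: permutes_in_image)
  then show "(if p v = v then [:0, 1::real:] else 0) - (if E v (p v) then 1 else 0)
      = (if p v = v then [:0, 1:] else 0) - (if F v (p v) then 1 else 0)" by simp
qed

lemma charpoly_empty [simp]: "charpoly {} E = 1"
  by (simp add: charpoly_def)

text \<open>In the Leibniz formula only permutations moving every vertex along an edge or not at
  all contribute; in a forest they are involutions, so they fix the root or swap it with a
  neighbour.\<close>

lemma charpoly_forest_rec:
  assumes f: "forest V E" and r: "r \<in> V"
  shows "charpoly V E = [:0, 1:] * charpoly (V - {r}) E
    - (\<Sum>c\<in>root_children V E r. charpoly (V - {r} - {c}) E)"
proof -
  have fin: "finite V" and irr: "\<And>u. u \<in> V \<Longrightarrow> \<not> E u u"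
    and sym: "\<And>u v. u \<in> V \<Longrightarrow> v \<in> V \<Longrightarrow> E u v \<Longrightarrow> E v u"
    using f unfolding forest_def simple_graph_def by blast+
  define t :: "'a \<Rightarrow> 'a \<Rightarrow> real poly"
    where "t v w = (if w = v then [:0, 1:] else 0) - (if E v w then 1 else 0)" for v w
  define wt where "wt U p = of_int (sign p) * (\<Prod>v\<in>U. t v (p v))" for U p
  have cp: "charpoly U E = (\<Sum>p | p permutes U. wt U p)" for U
    by (simp add: charpoly_def wt_def t_def)
  let ?N = "root_children V E r"
  \<comment> \<open>For c = r this is the set of permutations fixing the root, so one family covers
    both kinds of involution at r.\<close>
  define A where "A c = {p. p permutes V \<and> p r = c \<and> p c = r}" for c
  have finN: "finite ?N" and rN: "r \<notin> ?N" and NV: "?N \<subseteq> V"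
    using fin irr r by (auto simp: root_children_def)
  have finA: "finite (A c)" for c
    unfolding A_def by (rule finite_subset[OF _ finite_permutations[OF fin]]) auto
  have "charpoly V E = (\<Sum>p\<in>(\<Union>c\<in>insert r ?N. A c). wt V p)"
    unfolding cp
  proof (rule sum.mono_neutral_right)
    show "finite {p. p permutes V}" by (rule finite_permutations[OF fin])
    show "(\<Union>c\<in>insert r ?N. A c) \<subseteq> {p. p permutes V}" by (auto simp: A_def)
    show "\<forall>p\<in>{p. p permutes V} - (\<Union>c\<in>insert r ?N. A c). wt V p = 0"
    proof
      fix p assume p: "p \<in> {p. p permutes V} - (\<Union>c\<in>insert r ?N. A c)"
      then have pV: "p permutes V" by blast
      have "\<exists>v\<in>V. p v \<noteq> v \<and> \<not> E v (p v)"
      proof (rule ccontr)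
        assume "\<not> ?thesis"
        then have mv: "\<And>v. v \<in> V \<Longrightarrow> p v = v \<or> E v (p v)" by blast
        then have "p (p r) = r" by (rule forest_closed_walk_permutation[OF f pV])
        moreover have "p r \<in> insert r ?N"
          using mv[OF r] pV r by (auto simp: root_children_def permutes_in_image)
        ultimately show False using p pV by (auto simp: A_def)
      qed
      then show "wt V p = 0"
        using fin by (auto simp: wt_def t_def prod_zero_iff)
    qed
  qed
  also have "\<dots> = (\<Sum>c\<in>insert r ?N. \<Sum>p\<in>A c. wt V p)"
    using finN finA by (intro sum.UNION_disjoint) (auto simp: A_def)
  also have "\<dots> = (\<Sum>p\<in>A r. wt V p) + (\<Sum>c\<in>?N. \<Sum>p\<in>A c. wt V p)"
    using finN rN by simp
  also have "(\<Sum>p\<in>A r. wt V p) = [:0, 1:] * charpoly (V - {r}) E"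
  proof -
    have "A r = {p. p permutes (V - {r})}"
    proof (intro set_eqI iffI)
      fix p assume "p \<in> A r"
      then have pV: "p permutes V" and pr: "p r = r" by (auto simp: A_def)
      show "p \<in> {p. p permutes (V - {r})}"
        using permutes_superset[OF pV, of "V - {r}"] pr by auto
    next
      fix p assume "p \<in> {p. p permutes (V - {r})}"
      then have p: "p permutes (V - {r})" by simp
      then show "p \<in> A r"
        using permutes_subset[OF p, of V] permutes_not_in[OF p, of r] by (auto simp: A_def)
    qed
    moreover have "wt V p = [:0, 1:] * wt (V - {r}) p" if "p \<in> A r" for p
      using fin r irr that
      by (simp add: wt_def prod.remove[of V r] t_def A_def mult_ac)
    ultimately show ?thesis by (simp add: cp sum_distrib_left)
  qed
  also have "(\<Sum>c\<in>?N. \<Sum>p\<in>A c. wt V p) = (\<Sum>c\<in>?N. - charpoly (V - {r} - {c}) E)"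
  proof (rule sum.cong[OF refl])
    fix c assume c: "c \<in> ?N"
    have cr: "c \<noteq> r" "c \<in> V" "E r c" "E c r" using c rN sym r by (auto simp: root_children_def)
    let ?U = "V - {r} - {c}" and ?s = "Transposition.transpose r c"
    \<comment> \<open>Composing with the transposition of r and c removes the swap and reverses the
      sign; the two entries at r and c are both -1 and contribute 1. Hence the minus sign in the
      recursion.\<close>
    have "(\<Sum>p\<in>A c. wt V p) = (\<Sum>p | p permutes ?U. - wt ?U p)"
    proof (rule sum.reindex_bij_witness[of _ "\<lambda>p. ?s \<circ> p" "\<lambda>p. ?s \<circ> p"])
      fix p assume p: "p \<in> A c"
      then have pV: "p permutes V" "p r = c" "p c = r" by (auto simp: A_def)
      show "?s \<circ> (?s \<circ> p) = p" by (simp add: fun_eq_iff)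
      have sV: "?s permutes V" by (rule permutes_swap_id) (use r cr in auto)
      have s: "(?s \<circ> p) permutes V" using permutes_compose[OF pV(1) sV] .
      have sU: "(?s \<circ> p) permutes ?U"
        by (rule permutes_superset[OF s]) (use pV in auto)
      then show "?s \<circ> p \<in> {p. p permutes ?U}" by simp
      have pU: "permutation (?s \<circ> p)"
        using permutation_permutes sU fin by (metis finite_Diff)
      have "sign p = sign (?s \<circ> (?s \<circ> p))" by (simp add: comp_assoc[symmetric])
      also have "\<dots> = - sign (?s \<circ> p)"
        using cr pU by (subst sign_compose) (auto simp: permutation_swap_id sign_swap_id)
      finally have sg: "sign p = - sign (?s \<circ> p)" .
      have im: "(?s \<circ> p) v = p v" if v: "v \<in> ?U" for v
      proof -
        have "(?s \<circ> p) v \<in> ?U" using permutes_in_image[OF sU, of v] v by blast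
        then show ?thesis using cr by (auto simp: Transposition.transpose_def split: if_splits)
      qed
      have "(\<Prod>v\<in>V. t v (p v)) = t r (p r) * (t c (p c) * (\<Prod>v\<in>?U. t v (p v)))"
        using fin r cr by (simp add: prod.remove[of V r] prod.remove[of "V - {r}" c])
      also have "(\<Prod>v\<in>?U. t v (p v)) = (\<Prod>v\<in>?U. t v ((?s \<circ> p) v))"
        by (rule prod.cong[OF refl]) (simp only: im)
      finally have "wt V p = - wt ?U (?s \<circ> p)"
        using pV cr by (simp add: wt_def sg t_def)
      then show "- wt ?U (?s \<circ> p) = wt V p" by simp
    next
      fix p assume "p \<in> {p. p permutes ?U}"
      then have pU: "p permutes ?U" by simp
      have pV: "p permutes V" by (rule permutes_subset[OF pU]) auto
      have sV: "?s permutes V" by (rule permutes_swap_id) (use r cr in auto)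
      show "?s \<circ> (?s \<circ> p) = p" by (simp add: fun_eq_iff)
      show "?s \<circ> p \<in> A c"
        using permutes_compose[OF pV sV] permutes_not_in[OF pU, of r] permutes_not_in[OF pU, of c]
        by (auto simp: A_def)
    qed
    then show "(\<Sum>p\<in>A c. wt V p) = - charpoly ?U E" by (simp add: cp sum_negf)
  qed
  finally show ?thesis by (simp add: sum_negf)
qed

lemma forest_finite: "forest V E \<Longrightarrow> finite V"
  by (simp add: forest_def simple_graph_def)

lemma forest_irrefl: "forest V E \<Longrightarrow> u \<in> V \<Longrightarrow> \<not> E u u"
  by (simp add: forest_def simple_graph_def)

lemma forest_sym: "forest V E \<Longrightarrow> u \<in> V \<Longrightarrow> v \<in> V \<Longrightarrow> E u v \<Longrightarrow> E v u"
  unfolding forest_def simple_graph_def by blast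

lemma forest_Diff: "forest V E \<Longrightarrow> forest (V - S) E"
  by (rule forest_subset) auto

lemma root_childrenD:
  assumes "forest V E" "r \<in> V" "c \<in> root_children V E r"
  shows "c \<in> V" "c \<noteq> r" "E r c" "E c r" "c \<in> V - {r}"
  using assms forest_irrefl[of V E r] forest_sym[of V E r c] by (auto simp: root_children_def)

lemma finite_root_children: "forest V E \<Longrightarrow> finite (root_children V E r)"
  by (simp add: root_children_def forest_finite)

text \<open>The hypothesis is offered for all proper subsets because the expansion at a root
  descends by two vertices, to \<open>V - {r} - {c}\<close>. The vertex r only witnesses that V is
  nonempty; proofs that treat all roots at once ignore it.\<close>

lemma forest_induct [consumes 1, case_names empty root]:
  assumes "forest V E"
    and "P {}"
    and "\<And>V r. forest V E \<Longrightarrow> r \<in> V \<Longrightarrow> (\<And>U. U \<subset> V \<Longrightarrow> P U) \<Longrightarrow> P V"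
  shows "P V"
  using assms(1)
proof (induction "card V" arbitrary: V rule: less_induct)
  case less
  show ?case
  proof (cases "V = {}")
    case False
    then obtain r where "r \<in> V" by blast
    then show ?thesis
      using less assms(3)[of V r] forest_subset[OF less.prems]
      by (metis forest_finite psubsetE psubset_card_mono)
  qed (simp add: assms(2))
qed

lemma charpoly_monic:
  "forest V E \<Longrightarrow> degree (charpoly V E) = card V \<and> lead_coeff (charpoly V E) = 1"
proof (induction rule: forest_induct)
  case (root V r)
  let ?U = "V - {r}" and ?N = "root_children V E r"
  have fin: "finite V" using root by (simp add: forest_finite)
  have IH: "degree (charpoly ?U E) = card ?U" "lead_coeff (charpoly ?U E) = 1"
    using root.IH[of ?U] root.hyps by auto
  have c1: "card V = Suc (card ?U)" using fin root.hyps by (metis card.remove)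
  have ne: "charpoly ?U E \<noteq> 0" using IH(2) by auto
  have deg0: "degree ([:0, 1:] * charpoly ?U E) = Suc (card ?U)"
    using ne IH by (simp add: degree_pCons_eq)
  have deg: "degree (charpoly (?U - {c}) E) < Suc (card ?U)" if c: "c \<in> ?N" for c
  proof -
    have "?U - {c} \<subset> V" using root.hyps by auto
    then have "degree (charpoly (?U - {c}) E) = card (?U - {c})" using root.IH by blast
    also have "\<dots> \<le> card ?U" using fin by (intro card_mono) auto
    finally show ?thesis by simp
  qed
  have degs: "degree (\<Sum>c\<in>?N. charpoly (?U - {c}) E) < Suc (card ?U)"
    using deg finite_root_children[OF root.hyps(1)] by (intro degree_sum_less) auto
  have eq: "charpoly V E = [:0, 1:] * charpoly ?U E - (\<Sum>c\<in>?N. charpoly (?U - {c}) E)"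
    by (rule charpoly_forest_rec[OF root.hyps])
  have "degree (charpoly V E) = Suc (card ?U)"
    unfolding eq diff_conv_add_uminus using degs deg0 by (subst degree_add_eq_left) auto
  moreover have "coeff (charpoly V E) (Suc (card ?U)) = 1"
    unfolding eq using IH degs by (simp add: coeff_eq_0)
  ultimately show ?case using c1 by simp
qed simp

lemma charpoly_nonzero: "forest V E \<Longrightarrow> charpoly V E \<noteq> 0"
  using charpoly_monic[of V E] by auto

lemma poly_charpoly_rec:
  assumes "forest V E" "r \<in> V"
  shows "poly (charpoly V E) x = x * poly (charpoly (V - {r}) E) x
    - (\<Sum>c\<in>root_children V E r. poly (charpoly (V - {r} - {c}) E) x)"
  by (subst charpoly_forest_rec[OF assms]) (simp add: poly_sum)

text \<open>Multiplication by x makes up for one deleted vertex, and the other terms have lost two,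
  so all terms of the expansion share one parity. This is what makes the spectrum symmetric.\<close>

lemma charpoly_parity:
  "forest V E \<Longrightarrow> poly (charpoly V E) (- x) = (-1) ^ card V * poly (charpoly V E) x"
proof (induction rule: forest_induct)
  case (root V r)
  let ?U = "V - {r}" and ?N = "root_children V E r"
  have fin: "finite V" using root by (simp add: forest_finite)
  have c1: "card V = Suc (card ?U)" using fin root.hyps by (metis card.remove)
  have IH: "poly (charpoly (?U - {c}) E) (- x) = (-1) ^ card V * poly (charpoly (?U - {c}) E) x"
    if c: "c \<in> ?N" for c
  proof -
    have "c \<in> ?U" using root_childrenD[OF root.hyps c] by simp
    then have "card V = Suc (Suc (card (?U - {c})))" using fin c1 by (metis card.remove finite_Diff)
    moreover have "?U - {c} \<subset> V" using root.hyps by auto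
    ultimately show ?thesis using root.IH[of "?U - {c}"] by simp
  qed
  have "poly (charpoly ?U E) (- x) = (-1) ^ card ?U * poly (charpoly ?U E) x"
    using root by (intro root.IH) auto
  then show ?case
    using IH by (simp add: poly_charpoly_rec[OF root.hyps] c1 sum_distrib_left sum_negf algebra_simps)
qed simp

text \<open>\<open>Rpoly\<close> keeps only the coefficients with even \<open>n - k\<close>; by this
  lemma it drops nothing.\<close>

lemma charpoly_coeff_parity:
  assumes "forest V E" "k \<le> card V" "odd (card V - k)"
  shows "coeff (charpoly V E) k = 0"
proof -
  let ?p = "charpoly V E"
  have "poly (pcompose ?p [:0, -1:]) = poly (smult ((-1) ^ card V) ?p)"
    by (simp add: fun_eq_iff poly_pcompose charpoly_parity[OF assms(1)])
  then have "pcompose ?p [:0, -1:] = smult ((-1) ^ card V) ?p" by (simp only: poly_eq_poly_eq_iff)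
  then have "(-1) ^ k * coeff ?p k = (-1) ^ card V * coeff ?p k"
    by (metis coeff_pcompose_linear coeff_smult)
  moreover have "(-1::real) ^ card V = - ((-1) ^ k)"
    using assms(2,3) by (cases "even k") auto
  ultimately show ?thesis by simp
qed

section \<open>Splitting along components and edges\<close>

text \<open>Expand at a vertex of A: its neighbours all lie in A, so B is carried along as a common
  factor.\<close>

lemma charpoly_Un:
  assumes "forest (A \<union> B) E" "A \<inter> B = {}" "\<And>a b. a \<in> A \<Longrightarrow> b \<in> B \<Longrightarrow> \<not> E a b"
  shows "charpoly (A \<union> B) E = charpoly A E * charpoly B E"
proof -
  have "forest A E" using forest_subset[OF assms(1)] by blast
  then show ?thesis using assms
  proof (induction rule: forest_induct)
    case (root A r)
    have rB: "r \<notin> B" using root.hyps root.prems by blast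
    then have D: "A \<union> B - {r} = (A - {r}) \<union> B"
      "\<And>c. c \<in> A \<Longrightarrow> A \<union> B - {r} - {c} = (A - {r} - {c}) \<union> B"
      using root.prems by auto
    have N: "root_children (A \<union> B) E r = root_children A E r"
      using root.prems root.hyps by (auto simp: root_children_def)
    have f: "forest (U \<union> B) E" if "U \<subseteq> A" for U
      using forest_subset[OF root.prems(1)] that by blast
    have IH: "charpoly (U \<union> B) E = charpoly U E * charpoly B E" if "U \<subset> A" for U
      by (rule root.IH[OF that f]) (use that root.prems in blast)+
    have IH1: "charpoly (A - {r} \<union> B) E = charpoly (A - {r}) E * charpoly B E"
      using root.hyps by (intro IH) auto
    have IH2: "charpoly (A - {r} - {c} \<union> B) E = charpoly (A - {r} - {c}) E * charpoly B E" for c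
      using root.hyps by (intro IH) auto
    have "charpoly (A \<union> B) E = [:0, 1:] * charpoly (A - {r} \<union> B) E
        - (\<Sum>c\<in>root_children A E r. charpoly (A \<union> B - {r} - {c}) E)"
      using charpoly_forest_rec[OF root.prems(1), of r] root.hyps by (simp add: N D(1))
    also have "(\<Sum>c\<in>root_children A E r. charpoly (A \<union> B - {r} - {c}) E)
        = (\<Sum>c\<in>root_children A E r. charpoly (A - {r} - {c} \<union> B) E)"
      using root_childrenD(1)[OF root.hyps] by (intro sum.cong refl) (simp add: D(2))
    finally show ?case
      by (subst charpoly_forest_rec[OF root.hyps])
        (simp add: IH1 IH2 algebra_simps sum_distrib_left)
  qed simp
qed

lemma charpoly_UN:
  assumes "finite I" "forest (\<Union>i\<in>I. A i) E"
    and "\<And>i j. i \<in> I \<Longrightarrow> j \<in> I \<Longrightarrow> i \<noteq> j \<Longrightarrow> A i \<inter> A j = {}"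
    and "\<And>i j a b. i \<in> I \<Longrightarrow> j \<in> I \<Longrightarrow> i \<noteq> j \<Longrightarrow> a \<in> A i \<Longrightarrow> b \<in> A j \<Longrightarrow> \<not> E a b"
  shows "charpoly (\<Union>i\<in>I. A i) E = (\<Prod>i\<in>I. charpoly (A i) E)"
  using assms
proof (induction rule: finite_induct)
  case (insert i I)
  have "charpoly (A i \<union> (\<Union>i\<in>I. A i)) E = charpoly (A i) E * charpoly (\<Union>i\<in>I. A i) E"
  proof (rule charpoly_Un)
    show "forest (A i \<union> (\<Union>i\<in>I. A i)) E" using insert.prems(1) by simp
    show "A i \<inter> (\<Union>i\<in>I. A i) = {}" using insert.prems(2)[of i] insert.hyps by blast
    show "\<not> E a b" if "a \<in> A i" "b \<in> (\<Union>i\<in>I. A i)" for a b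
      using insert.prems(3)[of i _ a b] insert.hyps that by blast
  qed
  also have "charpoly (\<Union>i\<in>I. A i) E = (\<Prod>i\<in>I. charpoly (A i) E)"
  proof (rule insert.IH)
    show "forest (\<Union>i\<in>I. A i) E" by (rule forest_subset[OF insert.prems(1)]) auto
  qed (rule insert.prems(2,3); simp)+
  finally show ?case using insert.hyps by simp
qed simp

text \<open>In the expansion at r, the neighbours inside A together with the x-term reassemble the
  product of the two polynomials. The one extra neighbour s gives the correction, in which both ends
  of the joining edge are deleted.\<close>

lemma charpoly_Un_edge:
  assumes f: "forest (A \<union> B) E" and dj: "A \<inter> B = {}" and r: "r \<in> A" and s: "s \<in> B" and rs: "E r s"
    and cr: "\<And>a b. a \<in> A \<Longrightarrow> b \<in> B \<Longrightarrow> E a b \<Longrightarrow> a = r \<and> b = s"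
  shows "charpoly (A \<union> B) E = charpoly A E * charpoly B E - charpoly (A - {r}) E * charpoly (B - {s}) E"
proof -
  have fA: "forest A E" by (rule forest_subset[OF f]) auto
  have N: "root_children (A \<union> B) E r = insert s (root_children A E r)"
    using cr[OF r] s rs unfolding root_children_def by blast
  have sN: "s \<notin> root_children A E r" using s dj by (auto simp: root_children_def)
  have prod: "charpoly (U \<union> W) E = charpoly U E * charpoly W E" if "U \<subseteq> A - {r}" "W \<subseteq> B" for U W
  proof (rule charpoly_Un)
    show "forest (U \<union> W) E" by (rule forest_subset[OF f]) (use that in blast)
  qed (use cr dj that in blast)+
  have D: "A \<union> B - {r} = (A - {r}) \<union> B" "A \<union> B - {r} - {s} = (A - {r}) \<union> (B - {s})"
    using dj r s by auto
  have Dc: "A \<union> B - {r} - {c} = (A - {r} - {c}) \<union> B" if "c \<in> root_children A E r" for c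
    using that dj r by (auto simp: root_children_def)
  have P: "charpoly (A \<union> B - {r} - {c}) E = charpoly (A - {r} - {c}) E * charpoly B E"
    if "c \<in> root_children A E r" for c
    unfolding Dc[OF that] by (rule prod) auto
  have "charpoly (A \<union> B) E = [:0, 1:] * charpoly (A \<union> B - {r}) E
      - (charpoly (A \<union> B - {r} - {s}) E + (\<Sum>c\<in>root_children A E r. charpoly (A \<union> B - {r} - {c}) E))"
    using charpoly_forest_rec[OF f, of r] r sN finite_root_children[OF fA] by (simp add: N)
  also have "charpoly (A \<union> B - {r}) E = charpoly (A - {r}) E * charpoly B E"
    unfolding D by (rule prod) auto
  also have "charpoly (A \<union> B - {r} - {s}) E = charpoly (A - {r}) E * charpoly (B - {s}) E"
    unfolding D(2) by (rule prod) auto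
  finally show ?thesis
    by (simp add: P charpoly_forest_rec[OF fA r] left_diff_distrib sum_distrib_right mult.assoc)
qed

section \<open>Components and the branches at a root\<close>

definition reach :: "'a set \<Rightarrow> ('a \<Rightarrow> 'a \<Rightarrow> bool) \<Rightarrow> 'a \<Rightarrow> 'a set" where
  "reach A E c = {v. (adj_on A E)\<^sup>*\<^sup>* c v}"

lemma branch_eq_reach: "branch V E r c = reach (V - {r}) E c"
  by (simp add: branch_def reach_def)

lemma reach_refl [simp]: "c \<in> reach A E c"
  by (simp add: reach_def)

lemma reach_closed: "u \<in> reach A E c \<Longrightarrow> u \<in> A \<Longrightarrow> v \<in> A \<Longrightarrow> E u v \<Longrightarrow> v \<in> reach A E c"
  by (auto simp: reach_def adj_on_def intro: rtranclp.rtrancl_into_rtrancl)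

lemma reach_least:
  assumes "c \<in> X" "\<And>u v. u \<in> X \<Longrightarrow> u \<in> A \<Longrightarrow> v \<in> A \<Longrightarrow> E u v \<Longrightarrow> v \<in> X"
  shows "reach A E c \<subseteq> X"
proof
  fix v assume "v \<in> reach A E c"
  then have "(adj_on A E)\<^sup>*\<^sup>* c v" by (simp add: reach_def)
  then show "v \<in> X"
  proof (induction rule: rtranclp_induct)
    case (step y z)
    then show ?case using assms(2)[of y z] by (simp add: adj_on_def)
  qed (rule assms(1))
qed

lemma reach_subset: "c \<in> A \<Longrightarrow> reach A E c \<subseteq> A"
  by (rule reach_least)

lemma rtranclp_adj_on_sym:
  assumes "forest A E" "(adj_on A E)\<^sup>*\<^sup>* u v"
  shows "(adj_on A E)\<^sup>*\<^sup>* v u"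
proof -
  have "symp (adj_on A E)" using forest_sym[OF assms(1)] by (auto simp: symp_def adj_on_def)
  then have "symp (adj_on A E)\<^sup>*\<^sup>*" by (rule symp_rtranclp)
  then show ?thesis using assms(2) by (rule sympD)
qed

lemma reach_eq:
  assumes "forest A E" "d \<in> reach A E c"
  shows "reach A E d = reach A E c"
proof -
  have "(adj_on A E)\<^sup>*\<^sup>* c d" using assms(2) by (simp add: reach_def)
  moreover from this have "(adj_on A E)\<^sup>*\<^sup>* d c" by (rule rtranclp_adj_on_sym[OF assms(1)])
  ultimately show ?thesis unfolding reach_def by (blast intro: rtranclp_trans)
qed

text \<open>A walk that starts at c within A never leaves the component of c, hence is a walk in B
  already. This identifies branches of a subtree with branches of the whole tree.\<close>

lemma reach_restrict:
  assumes "B \<subseteq> A" "reach A E c \<subseteq> B"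
  shows "reach B E c = reach A E c"
proof
  show "reach B E c \<subseteq> reach A E c"
    using adj_on_mono[OF _ assms(1)] by (auto simp: reach_def)
  have "reach A E c \<subseteq> reach A E c \<inter> reach B E c"
  proof (rule reach_least)
    fix u v assume uv: "u \<in> reach A E c \<inter> reach B E c" "u \<in> A" "v \<in> A" "E u v"
    then have v: "v \<in> reach A E c" using reach_closed[of u A E c v] by blast
    then have "u \<in> B" "v \<in> B" using uv assms(2) by blast+
    then show "v \<in> reach A E c \<inter> reach B E c" using uv v reach_closed[of u B E c v] by blast
  qed simp
  then show "reach A E c \<subseteq> reach B E c" by blast
qed

lemma is_tree_reach:
  assumes f: "forest A E" and c: "c \<in> A"
  shows "is_tree (reach A E c) E"
proof -
  let ?C = "reach A E c"
  have CA: "?C \<subseteq> A" by (rule reach_subset[OF c])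
  have "reach ?C E c = ?C" by (rule reach_restrict) (use CA in auto)
  then have reach: "(adj_on ?C E)\<^sup>*\<^sup>* c v" if "v \<in> ?C" for v using that by (auto simp: reach_def)
  have fC: "forest ?C E" by (rule forest_subset[OF f CA])
  have "conn ?C E"
    unfolding conn_def
  proof (intro ballI)
    fix u v assume "u \<in> ?C" "v \<in> ?C"
    then have "(adj_on ?C E)\<^sup>*\<^sup>* u c" "(adj_on ?C E)\<^sup>*\<^sup>* c v"
      using reach rtranclp_adj_on_sym[OF fC] by simp_all
    then show "(adj_on ?C E)\<^sup>*\<^sup>* u v" by (rule rtranclp_trans)
  qed
  then show ?thesis using fC reach_refl unfolding is_tree_iff_forest by fastforce
qed

lemma branch_subset:
  "forest V E \<Longrightarrow> r \<in> V \<Longrightarrow> c \<in> root_children V E r \<Longrightarrow> branch V E r c \<subseteq> V - {r}"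
  unfolding branch_eq_reach by (rule reach_subset) (rule root_childrenD)

lemma is_tree_branch:
  "forest V E \<Longrightarrow> r \<in> V \<Longrightarrow> c \<in> root_children V E r \<Longrightarrow> is_tree (branch V E r c) E"
  unfolding branch_eq_reach by (rule is_tree_reach) (auto intro: forest_Diff dest: root_childrenD)

lemma in_branch [simp]: "c \<in> branch V E r c"
  by (simp add: branch_eq_reach)

text \<open>Two branches that meet are one component B with two edges to r. Since B is connected,
  adding r gives at least 2(card B - 1) + 4 ordered edges on card B + 1 vertices, while a forest
  allows 2 card B.\<close>

lemma branch_disjoint:
  assumes f: "forest V E" and r: "r \<in> V"
    and c: "c \<in> root_children V E r" and d: "d \<in> root_children V E r" and "c \<noteq> d"
  shows "branch V E r c \<inter> branch V E r d = {}"
proof (rule ccontr)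
  let ?B = "branch V E r c"
  assume "?B \<inter> branch V E r d \<noteq> {}"
  then obtain v where "v \<in> ?B" "v \<in> branch V E r d" by blast
  then have "?B = branch V E r d"
    unfolding branch_eq_reach using reach_eq[OF forest_Diff[OF f]] by metis
  then have cd: "{c, d} \<subseteq> {u \<in> ?B. E r u}"
    using c d by (metis (mono_tags, lifting) in_branch root_children_def mem_Collect_eq
        insert_subset empty_subsetI)
  have BV: "?B \<subseteq> V - {r}" by (rule branch_subset[OF f r c])
  have fB: "finite ?B" using finite_subset[OF BV] forest_finite[OF f] by simp
  have ins: "insert r ?B \<subseteq> V" using BV r by blast
  have "2 \<le> card {u \<in> ?B. E r u}"
    using card_mono[OF _ cd] fB \<open>c \<noteq> d\<close> by simp
  moreover have "2 * (card ?B - 1) \<le> edge_count ?B E"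
    using is_tree_branch[OF f r c] by (simp add: is_tree_iff_edge_count)
  moreover have "edge_count (insert r ?B) E = edge_count ?B E + 2 * card {u \<in> ?B. E r u}"
    using BV f ins by (intro edge_count_insert) (auto simp: forest_def intro: simple_graph_subset)
  moreover have "edge_count (insert r ?B) E \<le> 2 * (card (insert r ?B) - 1)"
    using f ins unfolding forest_def by blast
  moreover have "card (insert r ?B) = Suc (card ?B)"
    using fB BV by (metis DiffE card_insert_disjoint insertI1 subsetD)
  moreover have "card ?B > 0" using fB in_branch by (metis card_gt_0_iff empty_iff)
  ultimately show False by linarith
qed

lemma branch_no_edge:
  assumes f: "forest V E" and r: "r \<in> V"
    and c: "c \<in> root_children V E r" and d: "d \<in> root_children V E r" and cd: "c \<noteq> d"
    and ab: "a \<in> branch V E r c" "b \<in> branch V E r d"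
  shows "\<not> E a b"
proof
  assume "E a b"
  moreover have "a \<in> V - {r}" "b \<in> V - {r}"
    using ab branch_subset[OF f r c] branch_subset[OF f r d] by blast+
  ultimately have "b \<in> branch V E r c"
    using ab reach_closed unfolding branch_eq_reach by metis
  then show False using branch_disjoint[OF f r c d cd] ab by blast
qed

text \<open>The branches together with r are closed under adjacency, so they contain everything
  reachable from r, which is all of V by connectedness.\<close>

lemma UN_branch:
  assumes t: "is_tree V E" and r: "r \<in> V"
  shows "(\<Union>c\<in>root_children V E r. branch V E r c) = V - {r}"
proof
  have f: "forest V E" using t by (simp add: is_tree_iff_forest)
  let ?X = "\<Union>c\<in>root_children V E r. branch V E r c"
  have sub: "branch V E r c \<subseteq> V - {r}" if "c \<in> root_children V E r" for c
    by (rule branch_subset[OF f r that])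
  then show "?X \<subseteq> V - {r}" by blast
  have "reach V E r \<subseteq> insert r ?X"
  proof (rule reach_least)
    fix u v assume uv: "u \<in> insert r ?X" "u \<in> V" "v \<in> V" "E u v"
    show "v \<in> insert r ?X"
    proof (cases "u = r \<or> v = r")
      case True
      then show ?thesis using uv in_branch[of v V E r] by (auto simp: root_children_def)
    next
      case False
      then show ?thesis using uv reach_closed[of u "V - {r}" E _ v] by (auto simp: branch_eq_reach)
    qed
  qed simp
  moreover have "reach V E r = V"
    using t r reach_subset[OF r, of E] unfolding is_tree_def reach_def by blast
  ultimately show "V - {r} \<subseteq> ?X" by blast
qed

lemma charpoly_delete_root:
  assumes t: "is_tree V E" and r: "r \<in> V"
  shows "charpoly (V - {r}) E = (\<Prod>c\<in>root_children V E r. charpoly (branch V E r c) E)"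
proof -
  have f: "forest V E" using t by (simp add: is_tree_iff_forest)
  show ?thesis
    unfolding UN_branch[OF t r, symmetric]
    by (rule charpoly_UN)
      (use finite_root_children[OF f] branch_disjoint[OF f r] branch_no_edge[OF f r]
        UN_branch[OF t r] forest_Diff[OF f] in auto)
qed

lemma charpoly_delete_root_child:
  assumes t: "is_tree V E" and r: "r \<in> V" and c: "c \<in> root_children V E r"
  shows "charpoly (V - {r} - {c}) E = charpoly (branch V E r c - {c}) E
    * (\<Prod>d\<in>root_children V E r - {c}. charpoly (branch V E r d) E)"
proof -
  have f: "forest V E" using t by (simp add: is_tree_iff_forest)
  let ?N = "root_children V E r"
  define A where "A d = (if d = c then branch V E r c - {c} else branch V E r d)" for d
  have As: "A d \<subseteq> branch V E r d" for d by (auto simp: A_def)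
  have "c \<notin> branch V E r d" if "d \<in> ?N - {c}" for d
    using branch_disjoint[OF f r c, of d] that in_branch[of c V E r] by blast
  then have U: "V - {r} - {c} = (\<Union>d\<in>?N. A d)"
    unfolding UN_branch[OF t r, symmetric] using c by (auto simp: A_def)
  have "charpoly (\<Union>d\<in>?N. A d) E = (\<Prod>d\<in>?N. charpoly (A d) E)"
  proof (rule charpoly_UN[OF finite_root_children[OF f]])
    show "forest (\<Union>d\<in>?N. A d) E" unfolding U[symmetric] by (intro forest_Diff f)
    show "A i \<inter> A j = {}" if "i \<in> ?N" "j \<in> ?N" "i \<noteq> j" for i j
      using As branch_disjoint[OF f r that] by blast
    show "\<not> E a b" if "i \<in> ?N" "j \<in> ?N" "i \<noteq> j" "a \<in> A i" "b \<in> A j" for i j a b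
      using As branch_no_edge[OF f r that(1-3)] that by blast
  qed
  also have "\<dots> = charpoly (A c) E * (\<Prod>d\<in>?N - {c}. charpoly (A d) E)"
    using c finite_root_children[OF f] by (simp add: prod.remove)
  also have "(\<Prod>d\<in>?N - {c}. charpoly (A d) E) = (\<Prod>d\<in>?N - {c}. charpoly (branch V E r d) E)"
    by (intro prod.cong) (auto simp: A_def)
  finally show ?thesis by (simp add: U A_def)
qed

section \<open>Positivity to the right of the largest eigenvalue\<close>

lemma pderiv_sum: "pderiv (sum f A) = (\<Sum>x\<in>A. pderiv (f x))"
  by (induction A rule: infinite_finite_induct) (simp_all add: pderiv_add)

text \<open>The Wronskian of \<open>V\<close> and \<open>V - {r}\<close> is \<open>\<chi>\<^sub>V\<^sub>-\<^sub>r\<^sup>2\<close> plus the Wronskians of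
  \<open>V - {r}\<close> and \<open>V - {r, c}\<close> over the neighbours \<open>c\<close> of \<open>r\<close>.\<close>

lemma charpoly_wronskian:
  assumes "forest V E" "r \<in> V"
  shows "(poly (charpoly (V - {r}) E) x)\<^sup>2
    \<le> poly (pderiv (charpoly V E)) x * poly (charpoly (V - {r}) E) x
      - poly (charpoly V E) x * poly (pderiv (charpoly (V - {r}) E)) x"
proof -
  \<comment> \<open>The claim is proved for all roots at once because the induction hypothesis for
    \<open>V - {r}\<close> is needed at each neighbour c of r.\<close>
  have "\<forall>r\<in>V. (poly (charpoly (V - {r}) E) x)\<^sup>2
    \<le> poly (pderiv (charpoly V E)) x * poly (charpoly (V - {r}) E) x
      - poly (charpoly V E) x * poly (pderiv (charpoly (V - {r}) E)) x"
    using assms(1)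
  proof (induction rule: forest_induct)
    case (root V _)
    show ?case
    proof
      fix r assume r: "r \<in> V"
      let ?U = "V - {r}" and ?N = "root_children V E r"
      let ?P = "poly (charpoly ?U E) x" and ?P' = "poly (pderiv (charpoly ?U E)) x"
      let ?C = "\<lambda>c. poly (charpoly (?U - {c}) E) x" and ?C' = "\<lambda>c. poly (pderiv (charpoly (?U - {c}) E)) x"
      have "?U \<subset> V" using r by blast
      then have nn: "0 \<le> ?P' * ?C c - ?P * ?C' c" if "c \<in> ?N" for c
        using root.IH[of ?U] root_childrenD(5)[OF root.hyps(1) r that]
        by (meson order_trans zero_le_power2)
      have Q: "poly (charpoly V E) x = x * ?P - (\<Sum>c\<in>?N. ?C c)"
        by (rule poly_charpoly_rec[OF root.hyps(1) r])
      have Q': "poly (pderiv (charpoly V E)) x = ?P + x * ?P' - (\<Sum>c\<in>?N. ?C' c)"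
        by (subst charpoly_forest_rec[OF root.hyps(1) r])
          (simp add: pderiv_diff pderiv_mult pderiv_sum poly_sum pderiv_pCons)
      have "poly (pderiv (charpoly V E)) x * ?P - poly (charpoly V E) x * ?P'
          = ?P\<^sup>2 + (\<Sum>c\<in>?N. ?P' * ?C c - ?P * ?C' c)"
        unfolding Q Q' by (simp add: sum_subtractf sum_distrib_left[symmetric] algebra_simps power2_eq_square)
      then show "?P\<^sup>2 \<le> poly (pderiv (charpoly V E)) x * ?P - poly (charpoly V E) x * ?P'"
        using sum_nonneg[of ?N, OF nn] by simp
    qed
  qed simp
  then show ?thesis using assms(2) by blast
qed

text \<open>The numerator of the derivative is minus the Wronskian.\<close>

lemma charpoly_quotient_antimono:
  assumes f: "forest V E" "r \<in> V" and "x \<le> y" and nz: "\<And>z. x \<le> z \<Longrightarrow> z \<le> y \<Longrightarrow> poly (charpoly V E) z \<noteq> 0"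
  shows "poly (charpoly (V - {r}) E) y / poly (charpoly V E) y
    \<le> poly (charpoly (V - {r}) E) x / poly (charpoly V E) x"
proof (rule DERIV_nonpos_imp_nonincreasing[OF \<open>x \<le> y\<close>])
  fix z assume z: "x \<le> z" "z \<le> y"
  let ?P = "charpoly (V - {r}) E" and ?Q = "charpoly V E"
  have "((\<lambda>z. poly ?P z / poly ?Q z) has_real_derivative
    (poly (pderiv ?P) z * poly ?Q z - poly ?P z * poly (pderiv ?Q) z) / (poly ?Q z * poly ?Q z)) (at z)"
    by (intro DERIV_divide poly_DERIV nz z)
  moreover have "poly (pderiv ?P) z * poly ?Q z - poly ?P z * poly (pderiv ?Q) z \<le> 0"
    using charpoly_wronskian[OF f, of z] zero_le_power2[of "poly ?P z"]
    by (simp only: mult.commute)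
  ultimately show "\<exists>D. ((\<lambda>z. poly ?P z / poly ?Q z) has_real_derivative D) (at z) \<and> D \<le> 0"
    by (meson divide_nonpos_nonneg zero_le_square)
qed

text \<open>For the reciprocal quotient the numerator is the Wronskian itself, bounded below by a
  square that is positive away from the zeros of the denominator.\<close>

lemma charpoly_quotient_strict_mono:
  assumes f: "forest V E" "r \<in> V" and "x < y"
    and nz: "\<And>z. x \<le> z \<Longrightarrow> z \<le> y \<Longrightarrow> poly (charpoly (V - {r}) E) z \<noteq> 0"
  shows "poly (charpoly V E) x / poly (charpoly (V - {r}) E) x
    < poly (charpoly V E) y / poly (charpoly (V - {r}) E) y"
proof (rule DERIV_pos_imp_increasing[OF \<open>x < y\<close>])
  fix z assume z: "x \<le> z" "z \<le> y"
  let ?P = "charpoly (V - {r}) E" and ?Q = "charpoly V E"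
  have "((\<lambda>z. poly ?Q z / poly ?P z) has_real_derivative
    (poly (pderiv ?Q) z * poly ?P z - poly ?Q z * poly (pderiv ?P) z) / (poly ?P z * poly ?P z)) (at z)"
    by (intro DERIV_divide poly_DERIV nz z)
  moreover have "poly (pderiv ?Q) z * poly ?P z - poly ?Q z * poly (pderiv ?P) z > 0"
    using charpoly_wronskian[OF f, of z] nz[OF z] by (smt (verit) zero_less_power2)
  moreover have "poly ?P z * poly ?P z > 0" using nz[OF z] by (auto simp: zero_less_mult_iff)
  ultimately show "\<exists>D. ((\<lambda>z. poly ?Q z / poly ?P z) has_real_derivative D) (at z) \<and> 0 < D"
    by (meson divide_pos_pos)
qed

lemma charpoly_eventually_pos:
  assumes "forest V E"
  obtains b where "\<And>x. x \<ge> b \<Longrightarrow> poly (charpoly V E) x > 0"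
proof -
  have "\<exists>n. \<forall>x\<ge>n. lead_coeff (charpoly V E) \<le> poly (charpoly V E) x"
    using charpoly_monic[OF assms] by (intro poly_pinfty_gt_lc) linarith
  then show ?thesis using charpoly_monic[OF assms] that by (metis less_le_trans zero_less_one)
qed

lemma charpoly_pos_beyond_roots:
  assumes "forest V E" "\<And>y. y \<ge> x \<Longrightarrow> poly (charpoly V E) y \<noteq> 0"
  shows "poly (charpoly V E) x > 0"
proof (rule ccontr)
  assume "\<not> ?thesis"
  then have neg: "poly (charpoly V E) x < 0" using assms(2)[of x] by simp
  obtain b where b: "\<And>x. x \<ge> b \<Longrightarrow> poly (charpoly V E) x > 0"
    using charpoly_eventually_pos[OF assms(1)] by blast
  have "x < b" using b[of x] neg by linarith
  then show False using poly_IVT_pos[of x b "charpoly V E"] neg b[of b] assms(2) by force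
qed

text \<open>For a forest this says that no eigenvalue exceeds \<open>a\<close>, since the polynomial
  is monic. Stated as positivity, it passes through products and quotients without further sign
  arguments.\<close>

definition pos_above :: "'a set \<Rightarrow> ('a \<Rightarrow> 'a \<Rightarrow> bool) \<Rightarrow> real \<Rightarrow> bool" where
  "pos_above V E a \<longleftrightarrow> (\<forall>x>a. poly (charpoly V E) x > 0)"

lemma cyclotomic_iff_pos_above:
  assumes "forest V E"
  shows "cyclotomic V E \<longleftrightarrow> pos_above V E 2"
proof
  assume "cyclotomic V E"
  then show "pos_above V E 2"
    unfolding pos_above_def cyclotomic_def is_eigenvalue_def
    by (meson charpoly_pos_beyond_roots[OF assms] less_le_trans not_less)
next
  assume p: "pos_above V E 2"
  then have "poly (charpoly V E) x \<noteq> 0" if "x > 2 \<or> - x > 2" for x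
    using that charpoly_parity[OF assms, of x] unfolding pos_above_def by fastforce
  then show "cyclotomic V E" by (force simp: cyclotomic_def is_eigenvalue_def)
qed

text \<open>Interlacing at the largest eigenvalue: beyond \<open>a\<close> the quotient of the
  smaller polynomial by the larger is nonincreasing and positive far out, hence positive
  throughout.\<close>

lemma pos_above_delete:
  assumes f: "forest V E" and r: "r \<in> V" and p: "pos_above V E a"
  shows "pos_above (V - {r}) E a"
  unfolding pos_above_def
proof (intro allI impI, rule ccontr)
  fix x assume x: "x > a" "\<not> 0 < poly (charpoly (V - {r}) E) x"
  obtain b where b: "\<And>y. y \<ge> b \<Longrightarrow> poly (charpoly (V - {r}) E) y > 0"
    using charpoly_eventually_pos[OF forest_Diff[OF f]] by blast
  define y where "y = max b x"
  have pos: "poly (charpoly V E) z > 0" if "z \<ge> x" for z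
    using p that x by (auto simp: pos_above_def)
  have "poly (charpoly (V - {r}) E) y / poly (charpoly V E) y
    \<le> poly (charpoly (V - {r}) E) x / poly (charpoly V E) x"
    using pos by (intro charpoly_quotient_antimono[OF f r]) (force simp: y_def)+
  also have "\<dots> \<le> 0" using x pos[of x] by (simp add: divide_nonpos_pos)
  finally show False using b[of y] pos[of y] by (simp add: y_def divide_le_0_iff)
qed

lemma pos_above_subset:
  assumes "forest V E" "S \<subseteq> V" "pos_above V E a"
  shows "pos_above S E a"
  using assms
proof (induction rule: forest_induct)
  case (root V _)
  show ?case
  proof (cases "S = V")
    case False
    then obtain r where r: "r \<in> V" "r \<notin> S" using root.prems by blast
    show ?thesis
      by (rule root.IH[of "V - {r}"])
        (use r root.prems pos_above_delete[OF root.hyps(1) r(1)] in auto)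
  qed (use root.prems in simp)
qed simp

lemma poly_nonneg_of_pos_right:
  assumes "\<And>x. x > l \<Longrightarrow> poly p x > (0::real)"
  shows "poly p l \<ge> 0"
proof (rule tendsto_lowerbound)
  show "(poly p \<longlongrightarrow> poly p l) (at_right l)"
    using poly_isCont[of l p] by (simp add: isCont_def filterlim_at_split)
  show "\<forall>\<^sub>F x in at_right l. 0 \<le> poly p x"
    using assms by (auto simp: eventually_at_filter intro!: always_eventually less_imp_le)
qed simp

text \<open>Strictness needs connectedness: it fails for a forest two of whose components share the
  largest eigenvalue.\<close>

lemma pos_above_delete_strict:
  assumes "is_tree V E" "r \<in> V" "0 \<le> l" "pos_above V E l"
  shows "poly (charpoly (V - {r}) E) l > 0"
  using assms
proof (induction "card V" arbitrary: V r rule: less_induct)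
  case less
  let ?N = "root_children V E r" and ?B = "branch V E r"
  have f: "forest V E" using less.prems by (simp add: is_tree_iff_forest)
  note r = \<open>r \<in> V\<close>
  have "poly (charpoly (?B c) E) l > 0" if c: "c \<in> ?N" for c
  proof -
    have BV: "?B c \<subseteq> V - {r}" by (rule branch_subset[OF f r c])
    have posB: "pos_above (?B c) E l" if "c \<in> ?N" for c
      using branch_subset[OF f r that] by (intro pos_above_subset[OF f _ less.prems(4)]) auto
    have "card (?B c) < card V"
      using BV r forest_finite[OF f] by (intro psubset_card_mono) auto
    then have IH: "poly (charpoly (?B c - {c}) E) l > 0"
      using is_tree_branch[OF f r c] posB[OF c] less.prems(3) by (intro less.hyps) auto
    \<comment> \<open>Above l the expansion gives x \<chi>(V - r) > sum of the \<chi>(V - r - d);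
      keeping only the summand for c and cancelling the other branches makes \<open>?p\<close>
      positive. At l itself only \<open>?p\<close> \<ge> 0 survives, but the subtracted term is
      strictly positive by induction.\<close>
    let ?p = "[:0, 1:] * charpoly (?B c) E - charpoly (?B c - {c}) E"
    have "poly ?p x > 0" if x: "x > l" for x
    proof -
      let ?R = "\<Prod>d\<in>?N - {c}. poly (charpoly (?B d) E) x"
      have R: "?R > 0" using posB x by (intro prod_pos) (auto simp: pos_above_def)
      have dp: "poly (charpoly (V - {r} - {d}) E) x > 0" for d
        using pos_above_subset[OF f, of "V - {r} - {d}"] less.prems(4) x by (auto simp: pos_above_def)
      have "poly (charpoly (V - {r} - {c}) E) x \<le> (\<Sum>d\<in>?N. poly (charpoly (V - {r} - {d}) E) x)"
        using c finite_root_children[OF f] dp by (intro member_le_sum) (auto intro: less_imp_le)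
      also have "\<dots> < x * poly (charpoly (V - {r}) E) x"
        using less.prems(4) x unfolding pos_above_def poly_charpoly_rec[OF f r] by (simp del: poly_sum)
      finally have "?R * poly (charpoly (?B c - {c}) E) x < ?R * (x * poly (charpoly (?B c) E) x)"
        using c finite_root_children[OF f]
        by (simp add: charpoly_delete_root[OF less.prems(1) r] poly_prod prod.remove[of ?N c]
            charpoly_delete_root_child[OF less.prems(1) r c] mult_ac)
      then show ?thesis using R by simp
    qed
    then have "poly ?p l \<ge> 0" by (rule poly_nonneg_of_pos_right)
    then have "l * poly (charpoly (?B c) E) l > 0" using IH by simp
    then show ?thesis using less.prems(3) by (simp add: zero_less_mult_iff)
  qed
  then show ?case
    by (simp add: charpoly_delete_root[OF less.prems(1) r] poly_prod prod_pos)
qed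

text \<open>Two such branches give \<chi>(V - r) zeros x and y in the open interval from 2 to l. If
  x = y, every term of the expansion contains a vanishing factor, so x is a second eigenvalue above
  2. If not, \<chi>(V - r) / \<chi>(V) is nonincreasing between them and 0 at both ends, so a
  nonzero polynomial vanishes on an interval.\<close>

lemma at_most_one_noncyclotomic_branch:
  assumes t: "is_tree V E" and r: "r \<in> V" and c: "c \<in> root_children V E r" and d: "d \<in> root_children V E r"
    and cd: "c \<noteq> d" and l: "2 < l" "poly (charpoly V E) l = 0"
    and uniq: "\<And>x. x > 2 \<Longrightarrow> poly (charpoly V E) x = 0 \<Longrightarrow> x = l"
    and nc: "\<not> pos_above (branch V E r c) E 2"
  shows "pos_above (branch V E r d) E 2"
proof (rule ccontr)
  assume nd: "\<not> pos_above (branch V E r d) E 2"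
  have f: "forest V E" using t by (simp add: is_tree_iff_forest)
  let ?N = "root_children V E r" and ?P = "poly (charpoly (V - {r}) E)" and ?Q = "poly (charpoly V E)"
  have ex: "\<exists>x>2. poly (charpoly (branch V E r e) E) x = 0"
    if "e \<in> ?N" "\<not> pos_above (branch V E r e) E 2" for e
  proof -
    have fe: "forest (branch V E r e) E"
      using is_tree_branch[OF f r that(1)] by (simp add: is_tree_iff_forest)
    then show ?thesis
      using that(2) charpoly_pos_beyond_roots[OF fe] unfolding pos_above_def by force
  qed
  obtain x y where x: "x > 2" "poly (charpoly (branch V E r c) E) x = 0"
    and y: "y > 2" "poly (charpoly (branch V E r d) E) y = 0"
    using ex[OF c nc] ex[OF d nd] by blast
  have fin: "finite ?N" by (rule finite_root_children[OF f])
  have P0: "?P x = 0" "?P y = 0"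
    using x y c d fin by (auto simp: charpoly_delete_root[OF t r] poly_prod intro: prod_zero)
  have posV: "pos_above V E l"
    unfolding pos_above_def
  proof (intro allI impI)
    fix z assume "l < z"
    have "?Q y \<noteq> 0" if "y \<ge> z" for y
      using uniq[of y] \<open>l < z\<close> l(1) that by linarith
    then show "?Q z > 0" by (rule charpoly_pos_beyond_roots[OF f])
  qed
  \<comment> \<open>The endpoint l requires the strict version, which uses that V is
    connected.\<close>
  have Ppos: "?P z > 0" if "z \<ge> l" for z
    using pos_above_delete_strict[OF t r, of l] pos_above_delete[OF f r posV] posV l that
    by (cases "z = l") (auto simp: pos_above_def)
  have lt: "x < l" "y < l" using Ppos[of x] Ppos[of y] P0 by force+
  show False
  proof (cases "x = y")
    case True
    have "poly (charpoly (V - {r} - {e}) E) x = 0" if e: "e \<in> ?N" for e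
    proof -
      have "\<exists>e'\<in>?N - {e}. poly (charpoly (branch V E r e') E) x = 0"
        using c d cd x y True by (cases "e = c") auto
      then show ?thesis
        using fin by (auto simp: charpoly_delete_root_child[OF t r e] poly_prod intro: prod_zero)
    qed
    then have "?Q x = 0" using poly_charpoly_rec[OF f r, of x] P0 by simp
    then show False using uniq[of x] x lt by simp
  next
    case False
    define a b where "a = min x y" and "b = max x y"
    have ab: "a < b" "2 < a" "b < l" "?P a = 0" "?P b = 0"
      using False x y lt P0 by (auto simp: a_def b_def min_def max_def)
    have nz: "?Q z \<noteq> 0" if "a \<le> z" "z \<le> b" for z using uniq[of z] that ab by force
    have "?P z = 0" if z: "a \<le> z" "z \<le> b" for z
    proof -
      have "?P z / ?Q z \<le> ?P a / ?Q a"
        using z nz by (intro charpoly_quotient_antimono[OF f r]) auto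
      moreover have "?P b / ?Q b \<le> ?P z / ?Q z"
        using z nz by (intro charpoly_quotient_antimono[OF f r]) auto
      ultimately show ?thesis using ab nz[OF z] by simp
    qed
    then have "{a..b} \<subseteq> {z. ?P z = 0}" by auto
    moreover have "finite {z. ?P z = 0}"
      using charpoly_nonzero[OF forest_Diff[OF f]] by (rule poly_roots_finite)
    ultimately show False using ab infinite_Icc[of a b] finite_subset by blast
  qed
qed

section \<open>Reciprocal polynomials and nu-values\<close>

text \<open>Generic in the field, so that one identity for R serves real arguments, where \<nu>
  lives, and complex ones, where roots outside the unit circle are counted.\<close>

abbreviation evalp :: "real poly \<Rightarrow> 'b::real_field \<Rightarrow> 'b" where
  "evalp p z \<equiv> poly (map_poly of_real p) z"

lemma map_poly_of_real_add:
  "map_poly of_real (p + q) = (map_poly of_real p + map_poly of_real q :: 'b::real_field poly)"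
  by (rule poly_eqI) (simp add: coeff_map_poly)

lemma map_poly_of_real_diff:
  "map_poly of_real (p - q) = (map_poly of_real p - map_poly of_real q :: 'b::real_field poly)"
  by (rule poly_eqI) (simp add: coeff_map_poly)

lemma map_poly_of_real_mult:
  "map_poly of_real (p * q) = (map_poly of_real p * map_poly of_real q :: 'b::real_field poly)"
  by (rule poly_eqI) (simp add: coeff_map_poly coeff_mult)

lemma map_poly_of_real_smult:
  "map_poly of_real (smult c p) = (smult (of_real c) (map_poly of_real p) :: 'b::real_field poly)"
  by (rule poly_eqI) (simp add: coeff_map_poly)

lemma map_poly_of_real_monom:
  "map_poly of_real (monom c n) = (monom (of_real c) n :: 'b::real_field poly)"
  by (rule poly_eqI) (simp add: coeff_map_poly)

lemma map_poly_of_real_power: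
  "map_poly of_real (p ^ n) = (map_poly of_real p ^ n :: 'b::real_field poly)"
  by (induction n) (simp_all add: map_poly_of_real_mult)

lemma map_poly_of_real_sum:
  "map_poly of_real (sum f A) = (\<Sum>x\<in>A. map_poly of_real (f x) :: 'b::real_field poly)"
  by (induction A rule: infinite_finite_induct) (simp_all add: map_poly_of_real_add)

lemma map_poly_of_real_pderiv:
  "map_poly of_real (pderiv p) = (pderiv (map_poly of_real p) :: 'b::real_field poly)"
  by (rule poly_eqI) (simp add: coeff_map_poly coeff_pderiv)

lemmas map_poly_of_real_hom = map_poly_of_real_add map_poly_of_real_diff map_poly_of_real_mult
  map_poly_of_real_smult map_poly_of_real_monom map_poly_of_real_power map_poly_of_real_sum

lemma evalp_of_real: "evalp p (of_real x) = (of_real (poly p x) :: 'b::real_field)"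
  by (induction p) (simp_all add: map_poly_pCons)

lemma evalp_real [simp]: "evalp p x = poly p (x::real)"
  using evalp_of_real[where 'b = real] by simp

text \<open>This is the defining formula of R with z = w^2, free of square roots. Since w (w + 1/w)
  = 1 + w^2, each power of w + 1/w becomes a term of \<open>Rpoly\<close>; the terms with odd
  \<open>n - k\<close> have coefficient 0.\<close>

lemma evalp_Rpoly:
  assumes f: "forest V E" and w: "w \<noteq> (0 :: 'b::real_field)"
  shows "evalp (Rpoly V E) (w\<^sup>2) = w ^ card V * evalp (charpoly V E) (w + 1 / w)"
proof -
  let ?n = "card V" and ?c = "charpoly V E"
  have R: "evalp (Rpoly V E) (w\<^sup>2) = (\<Sum>k\<le>?n. if even (?n - k)
      then of_real (coeff ?c k) * ((1 + w\<^sup>2) ^ k * (w\<^sup>2) ^ ((?n - k) div 2)) else 0)"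
    unfolding Rpoly_def Let_def
    by (simp add: map_poly_of_real_hom poly_sum poly_monom map_poly_pCons if_distrib
        if_distribR add.commute cong: if_cong)
  have "w ^ ?n * evalp ?c (w + 1 / w)
      = (\<Sum>k\<le>?n. of_real (coeff ?c k) * (w ^ ?n * (w + 1 / w) ^ k))"
    using charpoly_monic[OF f]
    by (simp add: poly_altdef degree_map_poly coeff_map_poly sum_distrib_left mult_ac)
  also have "\<dots> = evalp (Rpoly V E) (w\<^sup>2)"
    unfolding R
  proof (rule sum.cong[OF refl])
    fix k assume k: "k \<in> {..?n}"
    have "w ^ ?n * (w + 1 / w) ^ k = w ^ (?n - k) * (w * (w + 1 / w)) ^ k"
      using k by (simp add: power_mult_distrib power_add[symmetric] mult.assoc[symmetric])
    also have "w * (w + 1 / w) = 1 + w\<^sup>2" using w by (simp add: field_simps power2_eq_square)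
    finally have e: "w ^ ?n * (w + 1 / w) ^ k = w ^ (?n - k) * (1 + w\<^sup>2) ^ k" .
    show "of_real (coeff ?c k) * (w ^ ?n * (w + 1 / w) ^ k) = (if even (?n - k)
      then of_real (coeff ?c k) * ((1 + w\<^sup>2) ^ k * (w\<^sup>2) ^ ((?n - k) div 2)) else 0)"
      using charpoly_coeff_parity[OF f, of k] k
      by (auto simp: e power_mult[symmetric] mult_ac)
  qed
  finally show ?thesis by simp
qed

lemma poly_Rpoly:
  "forest V E \<Longrightarrow> w \<noteq> 0 \<Longrightarrow> poly (Rpoly V E) (w\<^sup>2) = w ^ card V * poly (charpoly V E) (w + 1 / w)"
  using evalp_Rpoly[of V E w] by simp

text \<open>\<open>\<chi>\<^sub>V\<^sub>-\<^sub>r / \<chi>\<^sub>V\<close> maps the upper and lower half planes to each other, so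
  \<open>\<chi>\<^sub>V\<close> has only real zeros.\<close>

lemma charpoly_complex_nonzero:
  assumes "forest V E" "Im w \<noteq> 0"
  shows "evalp (charpoly V E) w \<noteq> 0"
proof -
  have "evalp (charpoly V E) w \<noteq> 0 \<and>
    (\<forall>r\<in>V. Im (evalp (charpoly (V - {r}) E) w / evalp (charpoly V E) w) * Im w < 0)"
    using assms(1)
  proof (induction rule: forest_induct)
    case (root V r0)
    have key: "evalp (charpoly V E) w \<noteq> 0 \<and>
      Im (evalp (charpoly (V - {r}) E) w / evalp (charpoly V E) w) * Im w < 0" if r: "r \<in> V" for r
    proof -
      let ?U = "V - {r}" and ?N = "root_children V E r"
      let ?P = "evalp (charpoly ?U E) w" and ?Q = "evalp (charpoly V E) w"
      let ?q = "\<lambda>c. evalp (charpoly (?U - {c}) E) w / ?P"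
      have IH: "?P \<noteq> 0" "\<And>c. c \<in> ?N \<Longrightarrow> Im (?q c) * Im w < 0"
        using root.IH[of ?U] r root_childrenD(5)[OF root.hyps(1) r] by blast+
      have "?Q = w * ?P - (\<Sum>c\<in>?N. evalp (charpoly (?U - {c}) E) w)"
        by (subst charpoly_forest_rec[OF root.hyps(1) r])
          (simp add: map_poly_of_real_hom poly_sum map_poly_pCons)
      then have Q: "?Q / ?P = w - (\<Sum>c\<in>?N. ?q c)"
        using IH(1) by (simp add: sum_divide_distrib[symmetric] diff_divide_distrib)
      have "(\<Sum>c\<in>?N. Im (?q c) * Im w) \<le> 0"
        using IH(2) by (intro sum_nonpos) (auto intro: less_imp_le)
      moreover have "Im (?Q / ?P) * Im w = Im w * Im w - (\<Sum>c\<in>?N. Im (?q c) * Im w)"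
        unfolding Q by (simp add: left_diff_distrib sum_distrib_right)
      moreover have "Im w * Im w > 0" using assms(2) by (auto simp: zero_less_mult_iff)
      ultimately have pos: "Im (?Q / ?P) * Im w > 0" by linarith
      define t where "t = ?Q / ?P"
      have t0: "t \<noteq> 0" using pos by (auto simp: t_def)
      have "?P / ?Q = 1 / t" by (simp add: t_def)
      moreover have "Im (1 / t) = - Im t / (norm t)\<^sup>2"
        by (simp add: Im_divide cmod_power2)
      ultimately have "Im (?P / ?Q) * Im w = - (Im t * Im w) / (norm t)\<^sup>2" by simp
      moreover have "(norm t)\<^sup>2 > 0" using t0 by simp
      ultimately have "Im (?P / ?Q) * Im w < 0"
        using pos unfolding t_def[symmetric] by (simp add: divide_neg_pos)
      \<comment> \<open>If \<chi>(V) vanished at w, the quotient would be 0 by convention and its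
        imaginary part could not give a negative product. So the strict inequality also yields
        nonvanishing.\<close>
      then show ?thesis by (metis div_by_0 mult_zero_left order_less_irrefl zero_complex.sel(2))
    qed
    then show ?case using root.hyps(2) by blast
  qed simp
  then show ?thesis ..
qed

text \<open>Positivity to the right of \<open>a\<close> is what makes the limit at a pole \<open>+\<infinity>\<close>.\<close>

lemma tendsto_cancelled_quotient:
  fixes p q :: "real poly"
  assumes p0: "p \<noteq> 0" and q0: "q \<noteq> 0" and pos: "\<And>z. z > a \<Longrightarrow> poly p z / poly q z > 0"
  defines "m \<equiv> order a q"
  shows "((\<lambda>z. ereal (poly p z / poly q z)) \<longlongrightarrow>
     (if order a p < m then PInfty
      else ereal (poly (p div [:-a, 1:] ^ m) a / poly (q div [:-a, 1:] ^ m) a))) (at_right a)"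
proof -
  let ?L = "[:-a, 1:]"
  obtain q1 where q1: "q = ?L ^ m * q1" "\<not> ?L dvd q1"
    using order_decomp[OF q0] unfolding m_def by blast
  obtain p1 where p1: "p = ?L ^ order a p * p1" "\<not> ?L dvd p1"
    using order_decomp[OF p0] by blast
  have q1a: "poly q1 a \<noteq> 0" and p1a: "poly p1 a \<noteq> 0"
    using q1(2) p1(2) by (auto simp: poly_eq_0_iff_dvd)
  have Ln: "?L ^ m \<noteq> 0" by simp
  have qd: "q div ?L ^ m = q1" by (subst q1(1)) simp
  have cont: "(poly f \<longlongrightarrow> poly f a) (at_right a)" for f :: "real poly"
    using poly_isCont[of a f] by (simp add: isCont_def filterlim_at_split)
  have gt: "\<forall>\<^sub>F z in at_right a. z > a" by (simp add: eventually_at_filter)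
  show ?thesis
  proof (cases "order a p < m")
    case True
    define j where "j = m - order a p"
    have j: "j > 0" "m = order a p + j" using True by (auto simp: j_def)
    have eq: "poly p z / poly q z = poly p1 z / poly q1 z * (1 / (z - a) ^ j)" if "z > a" for z
      by (subst p1(1), subst q1(1)) (use that in \<open>simp add: j(2) power_add\<close>)
    have lim: "((\<lambda>z. poly p1 z / poly q1 z) \<longlongrightarrow> poly p1 a / poly q1 a) (at_right a)"
      using q1a by (intro tendsto_divide cont)
    have pp: "poly p1 z / poly q1 z > 0" if "z > a" for z
    proof -
      have "poly p1 z / poly q1 z * (1 / (z - a) ^ j) > 0"
        using pos[OF that] by (simp only: eq[OF that])
      moreover have "1 / (z - a) ^ j > 0" using that by simp
      ultimately show ?thesis by (simp only: zero_less_mult_iff) linarith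
    qed
    have "poly p1 a / poly q1 a \<ge> 0"
      by (rule tendsto_lowerbound[OF lim]) (use gt pp in \<open>auto elim!: eventually_mono intro: less_imp_le\<close>)
    then have c: "poly p1 a / poly q1 a > 0" using p1a q1a by (simp add: less_le)
    have "((\<lambda>z. (z - a) ^ j) \<longlongrightarrow> 0) (at_right a)"
      using j by (auto intro!: tendsto_eq_intros)
    then have "filterlim (\<lambda>z. (z - a) ^ j) (at_right 0) (at_right a)"
      using gt by (auto simp: filterlim_at elim!: eventually_mono)
    then have "filterlim (\<lambda>z. inverse ((z - a) ^ j)) at_top (at_right a)"
      by (rule filterlim_compose[OF filterlim_inverse_at_top_right])
    then have "filterlim (\<lambda>z. poly p1 z / poly q1 z * (1 / (z - a) ^ j)) at_top (at_right a)"
      by (intro filterlim_tendsto_pos_mult_at_top[OF lim c]) (simp add: divide_inverse)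
    moreover have "\<forall>\<^sub>F z in at_right a. poly p z / poly q z = poly p1 z / poly q1 z * (1 / (z - a) ^ j)"
      using gt by eventually_elim (rule eq)
    ultimately have "filterlim (\<lambda>z. poly p z / poly q z) at_top (at_right a)"
      by (simp add: filterlim_cong)
    then show ?thesis using True by (simp add: tendsto_PInfty_eq_at_top)
  next
    case False
    then have "?L ^ m dvd p" using p0 by (simp add: order_divides)
    then obtain p2 where p2: "p = ?L ^ m * p2" by blast
    have pd: "p div ?L ^ m = p2" by (subst p2) simp
    have eq: "poly p z / poly q z = poly p2 z / poly q1 z" if "z > a" for z
      by (subst p2, subst q1(1)) (use that in simp)
    have "((\<lambda>z. ereal (poly p2 z / poly q1 z)) \<longlongrightarrow> ereal (poly p2 a / poly q1 a)) (at_right a)"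
      using q1a by (intro tendsto_intros cont) auto
    moreover have "\<forall>\<^sub>F z in at_right a. ereal (poly p z / poly q z) = ereal (poly p2 z / poly q1 z)"
      using gt by eventually_elim (simp add: eq)
    ultimately show ?thesis using False by (simp add: pd qd tendsto_cong)
  qed
qed

text \<open>The branch sizes add up to card V - 1, one less than the exponent in R of the whole
  tree. This is the source of the extra factor w between the two quotients.\<close>

lemma poly_quot_num:
  assumes t: "is_tree V E" and r: "r \<in> V" and w: "w \<noteq> 0"
  shows "poly (quot_num V E r) (w\<^sup>2) = w ^ (card V - 1) * poly (charpoly (V - {r}) E) (w + 1 / w)"
proof -
  have f: "forest V E" using t by (simp add: is_tree_iff_forest)
  let ?N = "root_children V E r" and ?B = "branch V E r"
  have "poly (quot_num V E r) (w\<^sup>2) = (\<Prod>c\<in>?N. w ^ card (?B c) * poly (charpoly (?B c) E) (w + 1 / w))"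
    unfolding quot_num_def poly_prod
    using is_tree_branch[OF f r] w
    by (intro prod.cong) (auto simp: is_tree_iff_forest poly_Rpoly)
  also have "\<dots> = w ^ (\<Sum>c\<in>?N. card (?B c)) * poly (charpoly (V - {r}) E) (w + 1 / w)"
    by (simp add: prod.distrib power_sum charpoly_delete_root[OF t r] poly_prod)
  also have "(\<Sum>c\<in>?N. card (?B c)) = card (\<Union>c\<in>?N. ?B c)"
    using finite_root_children[OF f] branch_disjoint[OF f r] is_tree_branch[OF f r]
    by (subst card_UN_disjoint) (auto simp: is_tree_def)
  also have "\<dots> = card V - 1" using UN_branch[OF t r] r forest_finite[OF f] by simp
  finally show ?thesis .
qed

section \<open>The substitution x = w + 1/w and \<nu> as a limit\<close>

lemma joukowski_gt: "w > 1 \<Longrightarrow> w + 1 / w > (2::real)"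
proof -
  assume "w > 1"
  moreover from this have "(w - 1)\<^sup>2 > 0" by simp
  ultimately show ?thesis by (simp add: field_simps power2_eq_square)
qed

text \<open>The larger solution w of w + 1/w = x for x > 2. It tends to 1 as x decreases to
  2.\<close>

definition joukowski_inv :: "real \<Rightarrow> real" where
  "joukowski_inv x = (x + sqrt (x\<^sup>2 - 4)) / 2"

lemma joukowski_inv:
  assumes "x > 2"
  shows "joukowski_inv x > 1" "joukowski_inv x + 1 / joukowski_inv x = x"
proof -
  let ?u = "joukowski_inv x"
  have "x\<^sup>2 > 2\<^sup>2" using assms by (intro power_strict_mono) auto
  then have s: "sqrt (x\<^sup>2 - 4) > 0" "(sqrt (x\<^sup>2 - 4))\<^sup>2 = x\<^sup>2 - 4" by simp_all
  show u1: "?u > 1" unfolding joukowski_inv_def using s(1) assms by (simp del: real_sqrt_gt_0_iff)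
  have "?u * ?u + 1 = x * ?u"
    using s(2) by (simp add: joukowski_inv_def field_simps power2_eq_square)
  then show "?u + 1 / ?u = x" using u1 by (simp add: field_simps)
qed

text \<open>The cancelled value at z = 1 is the limit of the quotient of the R; moving from z to x
  multiplies by w, which tends to 1. The hypothesis \<open>pos_above\<close> makes the quotient
  positive, as is required to get +\<infinity> at a pole.\<close>

lemma nu_tree_tendsto:
  assumes t: "is_tree V E" and r: "r \<in> V" and p: "pos_above V E 2"
  shows "((\<lambda>x. ereal (poly (charpoly (V - {r}) E) x / poly (charpoly V E) x)) \<longlongrightarrow> nu_tree V E r)
    (at_right 2)"
proof -
  have f: "forest V E" using t by (simp add: is_tree_iff_forest)
  let ?q = "\<lambda>x. poly (charpoly (V - {r}) E) x / poly (charpoly V E) x"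
  let ?g = "\<lambda>z. poly (quot_num V E r) z / poly (Rpoly V E) z"
  have c: "card V = Suc (card V - 1)" using r forest_finite[OF f] by (metis card_gt_0_iff Suc_pred' empty_iff)
  have g: "?q (w + 1 / w) = w * ?g (w\<^sup>2)" if "w > 0" for w
  proof -
    have "poly (Rpoly V E) (w\<^sup>2) = w * (w ^ (card V - 1) * poly (charpoly V E) (w + 1 / w))"
      using poly_Rpoly[OF f, of w] that
      by (metis c mult.assoc order_less_irrefl power_Suc)
    then show ?thesis using poly_quot_num[OF t r, of w] that by simp
  qed
  have qpos: "?q x > 0" if "x > 2" for x
    using p pos_above_delete[OF f r p] that by (simp add: pos_above_def)
  have gpos: "?g z > 0" if "z > 1" for z
  proof -
    have "sqrt z > 1" using that by simp
    then have sz: "sqrt z > 0" "sqrt z + 1 / sqrt z > 2" using joukowski_gt[of "sqrt z"] by auto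
    then have "sqrt z * ?g ((sqrt z)\<^sup>2) > 0"
      using qpos[OF sz(2)] by (simp only: g[OF sz(1)])
    then have "?g ((sqrt z)\<^sup>2) > 0" using sz(1) by (simp only: zero_less_mult_iff) linarith
    then show ?thesis using that by simp
  qed
  have "quot_num V E r \<noteq> 0" "Rpoly V E \<noteq> 0" using gpos[of 2] by auto
  from tendsto_cancelled_quotient[OF this gpos]
  have lim: "((\<lambda>z. ereal (?g z)) \<longlongrightarrow> nu_tree V E r) (at_right 1)"
    by (simp add: nu_tree_def Let_def)
  let ?u = "joukowski_inv"
  have gt: "\<forall>\<^sub>F x in at_right 2. x > (2::real)" by (simp add: eventually_at_filter)
  have ulim: "(?u \<longlongrightarrow> 1) (at_right 2)"
    unfolding joukowski_inv_def by (auto intro!: tendsto_eq_intros)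
  have "((\<lambda>x. (?u x)\<^sup>2) \<longlongrightarrow> 1) (at_right 2)"
    using tendsto_power[OF ulim, of 2] by simp
  moreover have "\<forall>\<^sub>F x in at_right 2. (?u x)\<^sup>2 > 1"
    using gt by eventually_elim (use joukowski_inv(1) in \<open>simp add: one_less_power\<close>)
  ultimately have "filterlim (\<lambda>x. (?u x)\<^sup>2) (at_right 1) (at_right 2)"
    by (auto simp: filterlim_at elim!: eventually_mono)
  then have "((\<lambda>x. ereal (?g ((?u x)\<^sup>2))) \<longlongrightarrow> nu_tree V E r) (at_right 2)"
    by (rule filterlim_compose[OF lim])
  \<comment> \<open>The first factor has the finite nonzero limit 1, so the product rule applies
    even if \<open>nu_tree V E r\<close> is infinite.\<close>
  then have "((\<lambda>x. ereal (?u x) * ereal (?g ((?u x)\<^sup>2))) \<longlongrightarrow> ereal 1 * nu_tree V E r) (at_right 2)"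
    using ulim by (intro tendsto_mult_ereal) auto
  moreover have "\<forall>\<^sub>F x in at_right 2. ereal (?u x) * ereal (?g ((?u x)\<^sup>2)) = ereal (?q x)"
    using gt
  proof eventually_elim
    case (elim x)
    then have "?q x = ?u x * ?g ((?u x)\<^sup>2)" using g[of "?u x"] joukowski_inv[of x] by simp
    then show ?case by simp
  qed
  ultimately have "((\<lambda>x. ereal (?q x)) \<longlongrightarrow> ereal 1 * nu_tree V E r) (at_right 2)"
    by (rule Lim_transform_eventually)
  then show ?thesis by (simp add: one_ereal_def[symmetric])
qed

section \<open>Trees with cyclotomic branches\<close>

lemma order_eq_1:
  fixes p :: "'a::field_char_0 poly"
  assumes "poly p a = 0" "poly (pderiv p) a \<noteq> 0"
  shows "order a p = 1"
proof -
  have "pderiv p \<noteq> 0" "p \<noteq> 0" using assms(2) by auto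
  then show ?thesis
    using order_pderiv[of p a] order_0I[OF assms(2)] assms(1) by (simp add: order_root)
qed

text \<open>Eigenvalues below -2 are settled by parity and bipartiteness by the forest property, so
  only the zeros above 2 remain to be checked.\<close>

lemma salem_treeI:
  assumes "is_tree V E" "l > 2" "poly (charpoly V E) l = 0" "poly (pderiv (charpoly V E)) l \<noteq> 0"
    and uniq: "\<And>x. x > 2 \<Longrightarrow> poly (charpoly V E) x = 0 \<Longrightarrow> x = l"
  shows "salem_tree V E"
proof -
  have f: "forest V E" using assms(1) by (simp add: is_tree_iff_forest)
  have "x = - l" if "poly (charpoly V E) x = 0" "x < -2" for x
    using charpoly_parity[OF f, of x] uniq[of "- x"] that by simp
  then show ?thesis
    using assms forest_bipartite[OF f] order_eq_1
    unfolding salem_tree_def salem_graph_def is_eigenvalue_def by blast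
qed

text \<open>Dividing the expansion at r by \<chi>(V - r), which factors over the branches, turns x -
  \<chi>(V) / \<chi>(V - r) into the sum of the branch quotients. Each of them is positive and
  nonincreasing above 2 and tends to the \<nu>-value of its branch.\<close>

lemma nu_forest_tendsto:
  assumes t: "is_tree V E" and r: "r \<in> V"
    and cyc: "\<forall>c\<in>root_children V E r. pos_above (branch V E r c) E 2"
  shows "\<And>x. x > 2 \<Longrightarrow> poly (charpoly (V - {r}) E) x > 0"
    and "((\<lambda>x. ereal (x - poly (charpoly V E) x / poly (charpoly (V - {r}) E) x)) \<longlongrightarrow> nu_forest V E r)
      (at_right 2)"
    and "\<And>x y. 2 < x \<Longrightarrow> x \<le> y \<Longrightarrow> y - poly (charpoly V E) y / poly (charpoly (V - {r}) E) y
      \<le> x - poly (charpoly V E) x / poly (charpoly (V - {r}) E) x"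
proof -
  have f: "forest V E" using t by (simp add: is_tree_iff_forest)
  let ?N = "root_children V E r" and ?B = "branch V E r"
  let ?q = "\<lambda>c x. poly (charpoly (?B c - {c}) E) x / poly (charpoly (?B c) E) x"
  have fin: "finite ?N" by (rule finite_root_children[OF f])
  have fB: "forest (?B c) E" if "c \<in> ?N" for c
    using is_tree_branch[OF f r that] by (simp add: is_tree_iff_forest)
  have B: "poly (charpoly (?B c) E) x > 0" if "c \<in> ?N" "x > 2" for c x
    using cyc that by (simp add: pos_above_def)
  show P: "poly (charpoly (V - {r}) E) x > 0" if "x > 2" for x
    using B that by (simp add: charpoly_delete_root[OF t r] poly_prod prod_pos)
  have S: "x - poly (charpoly V E) x / poly (charpoly (V - {r}) E) x = (\<Sum>c\<in>?N. ?q c x)"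
    if "x > 2" for x
  proof -
    have "poly (charpoly (V - {r} - {c}) E) x / poly (charpoly (V - {r}) E) x = ?q c x"
      if c: "c \<in> ?N" for c
    proof -
      define R where "R = (\<Prod>d\<in>?N - {c}. poly (charpoly (?B d) E) x)"
      have "R > 0" using B \<open>x > 2\<close> unfolding R_def by (intro prod_pos) auto
      moreover have "poly (charpoly (V - {r} - {c}) E) x = poly (charpoly (?B c - {c}) E) x * R"
        by (simp add: charpoly_delete_root_child[OF t r c] poly_prod R_def)
      moreover have "poly (charpoly (V - {r}) E) x = poly (charpoly (?B c) E) x * R"
        using c fin by (simp add: charpoly_delete_root[OF t r] poly_prod prod.remove[of ?N c] R_def)
      ultimately show ?thesis by simp
    qed
    then have "(\<Sum>c\<in>?N. poly (charpoly (V - {r} - {c}) E) x) / poly (charpoly (V - {r}) E) x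
        = (\<Sum>c\<in>?N. ?q c x)"
      by (simp add: sum_divide_distrib)
    then show ?thesis using P[OF that] by (simp add: poly_charpoly_rec[OF f r] diff_divide_distrib)
  qed
  have gt: "\<forall>\<^sub>F x in at_right 2. x > (2::real)" by (simp add: eventually_at_filter)
  have q: "((\<lambda>x. ereal (?q c x)) \<longlongrightarrow> nu_tree (?B c) E c) (at_right 2)" if "c \<in> ?N" for c
    using is_tree_branch[OF f r that] bspec[OF cyc that] by (intro nu_tree_tendsto) auto
  have qpos: "?q c x > 0" if "c \<in> ?N" "x > 2" for c x
    using B[OF that] pos_above_delete[OF fB[OF that(1)] in_branch bspec[OF cyc that(1)]] that
    by (simp add: pos_above_def)
  \<comment> \<open>Some limits may be infinite; nonnegativity rules out \<infinity> - \<infinity>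
    when they are added.\<close>
  have nn: "0 \<le> nu_tree (?B c) E c" if "c \<in> ?N" for c
  proof (rule tendsto_lowerbound[OF q[OF that]])
    show "\<forall>\<^sub>F x in at_right 2. 0 \<le> ereal (?q c x)"
      using gt by eventually_elim (use qpos[OF that] in \<open>simp add: less_imp_le\<close>)
  qed simp
  have "((\<lambda>x. \<Sum>c\<in>M. ereal (?q c x)) \<longlongrightarrow> (\<Sum>c\<in>M. nu_tree (?B c) E c)) (at_right 2)"
    if "M \<subseteq> ?N" for M
    using finite_subset[OF that fin] that
  proof (induction rule: finite_induct)
    case (insert c M)
    have "0 \<le> (\<Sum>c\<in>M. nu_tree (?B c) E c)" using insert.prems nn by (intro sum_nonneg) auto
    then show ?case
      using insert nn[of c] q[of c]
      by (simp del: sum_ereal) (intro tendsto_add_ereal_nonneg; auto)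
  qed (simp del: sum_ereal)
  then have "((\<lambda>x. ereal (\<Sum>c\<in>?N. ?q c x)) \<longlongrightarrow> nu_forest V E r) (at_right 2)"
    by (simp add: nu_forest_def)
  moreover have "\<forall>\<^sub>F x in at_right 2. ereal (\<Sum>c\<in>?N. ?q c x)
      = ereal (x - poly (charpoly V E) x / poly (charpoly (V - {r}) E) x)"
    using gt by eventually_elim (simp only: S)
  ultimately show "((\<lambda>x. ereal (x - poly (charpoly V E) x / poly (charpoly (V - {r}) E) x))
      \<longlongrightarrow> nu_forest V E r) (at_right 2)"
    by (rule Lim_transform_eventually)
  show "y - poly (charpoly V E) y / poly (charpoly (V - {r}) E) y
      \<le> x - poly (charpoly V E) x / poly (charpoly (V - {r}) E) x" if "2 < x" "x \<le> y" for x y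
  proof -
    have "(\<Sum>c\<in>?N. ?q c y) \<le> (\<Sum>c\<in>?N. ?q c x)"
    proof (rule sum_mono)
      fix c assume c: "c \<in> ?N"
      show "?q c y \<le> ?q c x"
      proof (rule charpoly_quotient_antimono[OF fB[OF c] in_branch that(2)])
        show "poly (charpoly (?B c) E) z \<noteq> 0" if "x \<le> z" for z
          using B[OF c, of z] \<open>2 < x\<close> that by simp
      qed
    qed
    then show ?thesis using S[of x] S[of y] that by simp
  qed
qed

text \<open>The nonincreasing sum of branch quotients never exceeds its limit at 2, hence is at most
  2 < x, so \<chi>(V) / \<chi>(V - r) is positive at x.\<close>

lemma pos_above_of_nu_forest_le:
  assumes t: "is_tree V E" and r: "r \<in> V"
    and cyc: "\<forall>c\<in>root_children V E r. pos_above (branch V E r c) E 2"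
    and nu: "nu_forest V E r \<le> 2"
  shows "pos_above V E 2"
  unfolding pos_above_def
proof (intro allI impI)
  fix x :: real assume x: "x > 2"
  let ?S = "\<lambda>x. x - poly (charpoly V E) x / poly (charpoly (V - {r}) E) x"
  note lims = nu_forest_tendsto[OF t r cyc]
  have "\<forall>\<^sub>F y in at_right 2. y \<in> {2<..<x}" using x by (rule eventually_at_right_real)
  then have "\<forall>\<^sub>F y in at_right 2. ereal (?S x) \<le> ereal (?S y)"
    by eventually_elim (use lims(3) in auto)
  then have "ereal (?S x) \<le> nu_forest V E r"
    by (rule tendsto_lowerbound[OF lims(2)]) simp
  then have "ereal (?S x) \<le> ereal 2" using nu by (metis order_trans numeral_eq_ereal)
  then have "poly (charpoly V E) x / poly (charpoly (V - {r}) E) x > 0" using x by simp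
  then show "poly (charpoly V E) x > 0" using lims(1)[OF x] by (simp add: zero_less_divide_iff)
qed

lemma cyclotomic_branches_iff_pos_above:
  assumes "is_tree V E" "r \<in> V"
  shows "(\<forall>c\<in>root_children V E r. cyclotomic_tree (branch V E r c) E)
    \<longleftrightarrow> (\<forall>c\<in>root_children V E r. pos_above (branch V E r c) E 2)"
  using is_tree_branch[of V E r] assms
  by (auto simp: cyclotomic_tree_def is_tree_iff_forest cyclotomic_iff_pos_above)

lemma typeA_quotient:
  assumes A: "typeA V E r"
  defines "f \<equiv> \<lambda>x. poly (charpoly V E) x / poly (charpoly (V - {r}) E) x"
  obtains l where "l > 2" "f l = 0" "\<And>x y. 2 < x \<Longrightarrow> x < y \<Longrightarrow> f x < f y"
    and "\<And>x. x > 2 \<Longrightarrow> poly (charpoly (V - {r}) E) x > 0"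
    and "((\<lambda>x. ereal (x - f x)) \<longlongrightarrow> nu_forest V E r) (at_right 2)"
proof -
  have t: "is_tree V E" and r: "r \<in> V" and nu: "nu_forest V E r > 2"
    and cyc: "\<forall>c\<in>root_children V E r. pos_above (branch V E r c) E 2"
    using A cyclotomic_branches_iff_pos_above[of V E r] by (auto simp: typeA_def)
  have fo: "forest V E" using t by (simp add: is_tree_iff_forest)
  note lims = nu_forest_tendsto[OF t r cyc, folded f_def]
  have mono: "f x < f y" if "2 < x" "x < y" for x y
    unfolding f_def
  proof (rule charpoly_quotient_strict_mono[OF fo r that(2)])
    show "poly (charpoly (V - {r}) E) z \<noteq> 0" if "x \<le> z" for z
      using lims(1)[of z] \<open>2 < x\<close> that by simp
  qed
  \<comment> \<open>Since \<nu> may be infinite, a real d strictly between 2 and \<nu> is used: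
    close to 2 one has x < d < x - f x, hence f x < 0, and the intermediate value theorem supplies
    the zero.\<close>
  obtain c :: ereal where c: "2 < c" "c < nu_forest V E r" using dense[OF nu] by blast
  then obtain d where d: "c = ereal d" by (cases c) auto
  have d2: "d > 2" using c(1) d by simp
  have "\<forall>\<^sub>F x in at_right 2. x \<in> {2<..<d}" using d2 by (rule eventually_at_right_real)
  moreover have "\<forall>\<^sub>F x in at_right 2. ereal d < ereal (x - f x)"
    using order_tendstoD(1)[OF lims(2)] c(2) unfolding d f_def by blast
  ultimately have "\<forall>\<^sub>F x in at_right 2. x > 2 \<and> f x < 0" by eventually_elim auto
  then obtain x where x: "x > 2" "f x < 0"
    using eventually_happens'[of "at_right (2::real)"] by auto
  then have Qx: "poly (charpoly V E) x < 0"
    using lims(1)[OF x(1)] by (simp add: f_def divide_less_0_iff)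
  obtain b where b: "\<And>x. x \<ge> b \<Longrightarrow> poly (charpoly V E) x > 0"
    using charpoly_eventually_pos[OF fo] by blast
  have "x < b" using b[of x] Qx by linarith
  then obtain l where "x < l" "poly (charpoly V E) l = 0"
    using poly_IVT_pos[of x b "charpoly V E"] Qx b[of b] by auto
  then show ?thesis using that[of l] x mono lims by (simp add: f_def)
qed

lemma typeA_salem_tree:
  assumes A: "typeA V E r"
  shows "salem_tree V E"
proof -
  have t: "is_tree V E" and r: "r \<in> V" using A by (auto simp: typeA_def)
  have f: "forest V E" using t by (simp add: is_tree_iff_forest)
  obtain l where l: "l > 2" "poly (charpoly V E) l / poly (charpoly (V - {r}) E) l = 0"
    and mono: "\<And>x y. 2 < x \<Longrightarrow> x < y \<Longrightarrow> poly (charpoly V E) x / poly (charpoly (V - {r}) E) x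
       < poly (charpoly V E) y / poly (charpoly (V - {r}) E) y"
    and P: "\<And>x. x > 2 \<Longrightarrow> poly (charpoly (V - {r}) E) x > 0"
    by (rule typeA_quotient[OF A]) blast
  have Q0: "poly (charpoly V E) l = 0" using l P[OF l(1)] by simp
  show ?thesis
  proof (rule salem_treeI[OF t l(1) Q0])
    \<comment> \<open>At a zero of \<chi>(V) the Wronskian reduces to the derivative times \<chi>(V
      - r), and it is at least a positive square.\<close>
    show "poly (pderiv (charpoly V E)) l \<noteq> 0"
      using charpoly_wronskian[OF f r, of l] Q0 P[OF l(1)] by auto
    show "x = l" if "x > 2" "poly (charpoly V E) x = 0" for x
      using mono[of x l] mono[of l x] that l by (cases x l rule: linorder_cases) auto
  qed
qed

text \<open>For (c) no \<nu>-value has to be computed: that it exceeds 2 is the contrapositive of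
  \<open>pos_above_of_nu_forest_le\<close>.\<close>

lemma typeA_of_noncyclotomic:
  assumes t: "is_tree V E" and r: "r \<in> V"
    and cyc: "\<forall>c\<in>root_children V E r. pos_above (branch V E r c) E 2"
    and "\<not> pos_above V E 2"
  shows "typeA V E r"
  using pos_above_of_nu_forest_le[OF t r cyc] assms cyclotomic_branches_iff_pos_above[OF t r]
  by (auto simp: typeA_def not_le[symmetric])

section \<open>Roots of the reciprocal polynomial outside the unit circle\<close>

text \<open>Differentiate R(w^2) = w^n \<chi>(w + 1/w) at w = a. The substitution has derivative 1 -
  1/a^2, nonzero for a > 1, so a simple zero stays simple.\<close>

lemma pderiv_Rpoly_nonzero:
  assumes f: "forest V E" and a: "a > 1" and Q: "poly (charpoly V E) (a + 1 / a) = 0"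
    and Q': "poly (pderiv (charpoly V E)) (a + 1 / a) \<noteq> 0"
  shows "poly (pderiv (Rpoly V E)) (a\<^sup>2) \<noteq> 0"
proof
  assume z: "poly (pderiv (Rpoly V E)) (a\<^sup>2) = 0"
  let ?n = "card V" and ?Q = "charpoly V E" and ?R = "Rpoly V E"
  have "((\<lambda>w. poly ?R (w\<^sup>2)) has_real_derivative poly (pderiv ?R) (a\<^sup>2) * (2 * a)) (at a)"
    by (auto intro!: derivative_eq_intros poly_DERIV[THEN DERIV_chain2])
  moreover have "\<forall>\<^sub>F w in nhds a. poly ?R (w\<^sup>2) = w ^ ?n * poly ?Q (w + 1 / w)"
    using a eventually_nhds_in_open[of "{0<..}" a]
    by (auto elim!: eventually_mono simp: poly_Rpoly[OF f])
  ultimately have "((\<lambda>w. w ^ ?n * poly ?Q (w + 1 / w)) has_real_derivative 0) (at a)"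
    by (simp add: z DERIV_cong_ev)
  moreover have "((\<lambda>w. w ^ ?n * poly ?Q (w + 1 / w)) has_real_derivative
      a ^ ?n * (poly (pderiv ?Q) (a + 1 / a) * (1 - 1 / a\<^sup>2))) (at a)"
  proof -
    have "((\<lambda>w. w + 1 / w) has_real_derivative 1 - 1 / a\<^sup>2) (at a)"
      using a by (auto intro!: derivative_eq_intros simp: power2_eq_square)
    from DERIV_mult[OF DERIV_pow DERIV_chain2[OF poly_DERIV this], of ?n ?Q]
    show ?thesis using Q by (simp add: mult.commute)
  qed
  ultimately have "a ^ ?n * (poly (pderiv ?Q) (a + 1 / a) * (1 - 1 / a\<^sup>2)) = 0"
    using DERIV_unique by blast
  moreover have "a\<^sup>2 > 1" using a by (simp add: one_less_power)
  ultimately show False using a Q' by simp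
qed

text \<open>For a root z = w^2 with |w| > 1, the number w + 1/w is a zero of \<chi> and hence real.
  As Im (w + 1/w) = Im w (1 - 1/|w|^2), w is real too. So the roots correspond to reals w > 1, and
  these to the zeros x > 2; simplicity makes every multiplicity 1.\<close>

lemma roots_outside_Rpoly:
  assumes f: "forest V E"
    and simple: "\<And>x. x > 2 \<Longrightarrow> poly (charpoly V E) x = 0 \<Longrightarrow> poly (pderiv (charpoly V E)) x \<noteq> 0"
  shows "roots_outside (Rpoly V E) = card {x. x > 2 \<and> poly (charpoly V E) x = 0}"
proof -
  let ?R = "map_poly complex_of_real (Rpoly V E)" and ?Q = "charpoly V E"
  let ?Z = "{z. poly ?R z = 0 \<and> cmod z > 1}" and ?X = "{x. x > 2 \<and> poly ?Q x = 0}"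
  define W where "W = {a. a > 1 \<and> poly ?Q (a + 1 / a) = 0}"
  let ?h = "\<lambda>a. complex_of_real (a\<^sup>2)"
  have RW: "poly ?R (?h a) = 0" if "a \<in> W" for a
    using that poly_Rpoly[OF f, of a] by (simp only: evalp_of_real) (auto simp: W_def)
  have Z: "?Z = ?h ` W"
  proof (intro set_eqI iffI)
    fix z assume "z \<in> ?Z"
    then have z: "poly ?R z = 0" "cmod z > 1" by auto
    define w where "w = csqrt z"
    have w2: "w\<^sup>2 = z" by (simp add: w_def)
    have nw: "cmod w > 1"
      using z(2) unfolding w2[symmetric] norm_power by (meson norm_ge_zero not_less power_le_one)
    then have w0: "w \<noteq> 0" by auto
    have "evalp ?Q (w + 1 / w) = 0"
      using evalp_Rpoly[OF f w0] z(1) w0 by (simp add: w2)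
    then have im: "Im (w + 1 / w) = 0" using charpoly_complex_nonzero[OF f, of "w + 1 / w"] by blast
    have "Im (w + 1 / w) = Im w * (1 - 1 / (cmod w)\<^sup>2)"
      by (simp add: Im_divide cmod_power2 algebra_simps)
    moreover have "(cmod w)\<^sup>2 > 1" using nw by (simp add: one_less_power)
    ultimately have "Im w = 0" using im by simp
    then have wr: "w = of_real (Re w)" by (simp add: complex_eq_iff)
    \<comment> \<open>The principal square root excludes w < -1, so each z arises from exactly one
      w.\<close>
    have "Re w \<ge> 0" using csqrt_principal[of z] by (auto simp: w_def)
    moreover have "\<bar>Re w\<bar> > 1" using nw by (subst (asm) wr) simp
    ultimately have re: "Re w > 1" by simp
    have "evalp ?Q (w + 1 / w) = (of_real (poly ?Q (Re w + 1 / Re w)) :: complex)"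
      unfolding evalp_of_real[symmetric] by (subst (1 2) wr) simp
    then have "Re w \<in> W" using re \<open>evalp ?Q (w + 1 / w) = 0\<close> by (simp add: W_def)
    moreover have "z = ?h (Re w)" using w2 by (subst (asm) wr) simp
    ultimately show "z \<in> ?h ` W" by blast
  next
    fix z assume "z \<in> ?h ` W"
    then obtain a where a: "a \<in> W" "z = ?h a" by blast
    then have "a\<^sup>2 > 1" by (simp add: W_def one_less_power)
    then show "z \<in> ?Z" using RW[OF a(1)] a(2) by (simp del: of_real_power)
  qed
  have injh: "inj_on ?h W" by (auto simp: inj_on_def W_def power2_eq_iff simp del: of_real_power)
  have "order z ?R = 1" if "z \<in> ?Z" for z
  proof -
    have "z \<in> ?h ` W" using that by (simp only: Z)
    then obtain a where a: "a \<in> W" "z = ?h a" by blast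
    have "poly (pderiv (Rpoly V E)) (a\<^sup>2) \<noteq> 0"
      using a simple[of "a + 1 / a"] joukowski_gt[of a]
      by (intro pderiv_Rpoly_nonzero[OF f]) (auto simp: W_def)
    then have "poly (pderiv ?R) z \<noteq> 0"
      unfolding a(2) map_poly_of_real_pderiv[symmetric] evalp_of_real by simp
    then show ?thesis using RW[OF a(1)] a(2) by (intro order_eq_1) auto
  qed
  then have "roots_outside (Rpoly V E) = card ?Z" by (simp add: roots_outside_def)
  also have "\<dots> = card W" unfolding Z by (rule card_image[OF injh])
  also have "\<dots> = card ?X"
  proof (rule bij_betw_same_card[of "\<lambda>a. a + 1 / a"])
    show "bij_betw (\<lambda>a. a + 1 / a) W ?X"
      unfolding bij_betw_def
    proof
      show "inj_on (\<lambda>a. a + 1 / a) W"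
      proof (rule inj_onI)
        fix a b assume ab: "a \<in> W" "b \<in> W" "a + 1 / a = b + 1 / b"
        then have g: "a > 1" "b > 1" by (auto simp: W_def)
        then have "(a - b) * (a * b - 1) = 0" using ab(3) by (simp add: field_simps)
        moreover have "a * b > 1" using g by (simp add: less_1_mult)
        ultimately show "a = b" by simp
      qed
      show "(\<lambda>a. a + 1 / a) ` W = ?X"
      proof (intro set_eqI iffI)
        fix x assume "x \<in> ?X"
        then have "joukowski_inv x \<in> W" "x = joukowski_inv x + 1 / joukowski_inv x"
          using joukowski_inv[of x] by (auto simp: W_def)
        then show "x \<in> (\<lambda>a. a + 1 / a) ` W" by blast
      qed (auto simp: W_def joukowski_gt)
    qed
  qed
  finally show ?thesis .
qed

section \<open>Joining and splitting along an edge\<close>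

text \<open>With \<open>f\<^sub>i = \<chi>\<^sub>T\<^sub>i / \<chi>\<^sub>T\<^sub>i\<^sub>'\<close>, the eigenvalues of \<open>T\<^sub>1 + T\<^sub>2\<close> above 2 solve
  \<open>f\<^sub>1 f\<^sub>2 = 1\<close>. Beyond both zeros of \<open>f\<^sub>1\<close> and \<open>f\<^sub>2\<close> the product increases from 0 to infinity; below
  both it decreases from \<open>(\<nu>\<^sub>1 - 2) (\<nu>\<^sub>2 - 2)\<close> to 0; in between it is not positive.\<close>

lemma edge_join_eigenvalues:
  assumes A1: "typeA A E1 r" and A2: "typeA B E2 s" and t: "is_tree V E"
    and eq: "charpoly V E = charpoly A E1 * charpoly B E2
      - charpoly (A - {r}) E1 * charpoly (B - {s}) E2"
  defines "N \<equiv> (nu_forest A E1 r - 2) * (nu_forest B E2 s - 2)"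
  obtains L where "L > 2" "poly (charpoly V E) L = 0"
    and "\<And>x. x > 2 \<Longrightarrow> poly (charpoly V E) x = 0 \<Longrightarrow> poly (pderiv (charpoly V E)) x \<noteq> 0"
    and "N \<le> 1 \<Longrightarrow> {x. x > 2 \<and> poly (charpoly V E) x = 0} = {L}"
    and "N > 1 \<Longrightarrow> \<exists>k. k \<noteq> L \<and> {x. x > 2 \<and> poly (charpoly V E) x = 0} = {k, L}"
proof -
  let ?Q = "charpoly V E"
  let ?Q1 = "charpoly A E1" and ?P1 = "charpoly (A - {r}) E1"
  let ?Q2 = "charpoly B E2" and ?P2 = "charpoly (B - {s}) E2"
  define f1 where "f1 x = poly ?Q1 x / poly ?P1 x" for x
  define f2 where "f2 x = poly ?Q2 x / poly ?P2 x" for x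
  have fV: "forest V E" using t by (simp add: is_tree_iff_forest)
  have fA: "forest A E1" "r \<in> A" and fB: "forest B E2" "s \<in> B"
    and nu: "nu_forest A E1 r > 2" "nu_forest B E2 s > 2"
    using A1 A2 by (auto simp: typeA_def is_tree_iff_forest)
  obtain l1 where l1: "l1 > 2" "f1 l1 = 0" and m1: "\<And>x y. 2 < x \<Longrightarrow> x < y \<Longrightarrow> f1 x < f1 y"
    and P1: "\<And>x. x > 2 \<Longrightarrow> poly ?P1 x > 0"
    and lim1: "((\<lambda>x. ereal (x - f1 x)) \<longlongrightarrow> nu_forest A E1 r) (at_right 2)"
    unfolding f1_def by (rule typeA_quotient[OF A1]) blast
  obtain l2 where l2: "l2 > 2" "f2 l2 = 0" and m2: "\<And>x y. 2 < x \<Longrightarrow> x < y \<Longrightarrow> f2 x < f2 y"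
    and P2: "\<And>x. x > 2 \<Longrightarrow> poly ?P2 x > 0"
    and lim2: "((\<lambda>x. ereal (x - f2 x)) \<longlongrightarrow> nu_forest B E2 s) (at_right 2)"
    unfolding f2_def by (rule typeA_quotient[OF A2]) blast
  define g where "g x = f1 x * f2 x" for x
  define m where "m = min l1 l2"
  define M where "M = max l1 l2"
  have mM: "2 < m" "m \<le> M" "2 < M" using l1 l2 by (auto simp: m_def M_def)
  have Qg: "poly ?Q x = poly ?P1 x * poly ?P2 x * (g x - 1)" if "x > 2" for x
    using P1[OF that] P2[OF that] by (simp add: eq g_def f1_def f2_def field_simps)
  have Q0: "poly ?Q x = 0 \<longleftrightarrow> g x = 1" and Qneg: "poly ?Q x < 0 \<longleftrightarrow> g x < 1"
    and Qpos: "poly ?Q x > 0 \<longleftrightarrow> g x > 1" if "x > 2" for x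
    using mult_pos_pos[OF P1[OF that] P2[OF that]]
    by (auto simp: Qg[OF that] mult_less_0_iff zero_less_mult_iff)
  have low: "f1 x < 0" "f2 x < 0" if "2 < x" "x < m" for x
    using m1[of x l1] m2[of x l2] that l1 l2 by (auto simp: m_def)
  have high: "f1 x > 0" "f2 x > 0" if "x > M" for x
    using m1[of l1 x] m2[of l2 x] that l1 l2 by (auto simp: M_def)
  have mid: "g x \<le> 0" if "m \<le> x" "x \<le> M" for x
  proof (cases "l1 \<le> l2")
    case True
    then have "f1 x \<ge> 0" "f2 x \<le> 0"
      using m1[of l1 x] m2[of x l2] that l1 l2 mM by (cases "x = l1"; cases "x = l2"; force simp: m_def M_def)+
    then show ?thesis by (simp add: g_def mult_nonneg_nonpos)
  next
    case False
    then have "f1 x \<le> 0" "f2 x \<ge> 0"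
      using m1[of x l1] m2[of l2 x] that l1 l2 mM by (cases "x = l1"; cases "x = l2"; force simp: m_def M_def)+
    then show ?thesis by (simp add: g_def mult_nonpos_nonneg)
  qed
  have decr: "g y < g x" if "2 < x" "x < y" "y < m" for x y
  proof -
    have "(- f1 y) * (- f2 y) < (- f1 x) * (- f2 x)"
      using m1[of x y] m2[of x y] low[of y] that by (intro mult_strict_mono) auto
    then show ?thesis by (simp add: g_def)
  qed
  have incr: "g x < g y" if "M < x" "x < y" for x y
    unfolding g_def using m1[of x y] m2[of x y] high[of x] high[of y] that mM
    by (intro mult_strict_mono) auto
  \<comment> \<open>At a double zero f1 f2 = 1 and its derivative is 0. Cleared of denominators, the
    latter says that the Wronskians \<open>w1\<close> and \<open>w2\<close>, weighted by q2 p2 and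
    q1 p1, sum to 0. But both Wronskians are positive, and the weights share a sign because their
    product is a positive square.\<close>
  have simple: "poly (pderiv ?Q) x \<noteq> 0" if x: "x > 2" "poly ?Q x = 0" for x
  proof
    assume d: "poly (pderiv ?Q) x = 0"
    let ?q1 = "poly ?Q1 x" and ?p1 = "poly ?P1 x" and ?q2 = "poly ?Q2 x" and ?p2 = "poly ?P2 x"
    let ?dq1 = "poly (pderiv ?Q1) x" and ?dp1 = "poly (pderiv ?P1) x"
    let ?dq2 = "poly (pderiv ?Q2) x" and ?dp2 = "poly (pderiv ?P2) x"
    define w1 where "w1 = ?dq1 * ?p1 - ?q1 * ?dp1"
    define w2 where "w2 = ?dq2 * ?p2 - ?q2 * ?dp2"
    have w: "w1 > 0" "w2 > 0"
      using charpoly_wronskian[OF fA, of x] charpoly_wronskian[OF fB, of x] P1[OF x(1)] P2[OF x(1)]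
      unfolding w1_def w2_def by (smt (verit) zero_less_power)+
    have e: "?q1 * ?q2 = ?p1 * ?p2" using x(2) by (simp add: eq)
    have "?dq1 * ?q2 + ?q1 * ?dq2 = ?dp1 * ?p2 + ?p1 * ?dp2"
      using d by (simp add: eq pderiv_diff pderiv_mult algebra_simps)
    then have "w1 * (?q2 * ?p2) + w2 * (?q1 * ?p1) = 0"
      using e unfolding w1_def w2_def by algebra
    moreover have pos: "(?q2 * ?p2) * (?q1 * ?p1) > 0"
    proof -
      have "(?q2 * ?p2) * (?q1 * ?p1) = (?p1 * ?p2)\<^sup>2"
        using e by (simp add: power2_eq_square mult_ac)
      then show ?thesis using P1[OF x(1)] P2[OF x(1)] by simp
    qed
    ultimately show False
    proof (cases "?q2 * ?p2 > 0")
      case True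
      then have "?q1 * ?p1 > 0" using zero_less_mult_pos[OF pos] by blast
      then have "w1 * (?q2 * ?p2) > 0" "w2 * (?q1 * ?p1) > 0"
        using True w by (simp_all only: mult_pos_pos)
      then show False using \<open>w1 * (?q2 * ?p2) + w2 * (?q1 * ?p1) = 0\<close> by linarith
    next
      case False
      then have "?q2 * ?p2 < 0" "?q1 * ?p1 < 0" using iffD1[OF zero_less_mult_iff pos] by blast+
      then have "w1 * (?q2 * ?p2) < 0" "w2 * (?q1 * ?p1) < 0"
        using w by (simp_all only: mult_pos_neg)
      then show False using \<open>w1 * (?q2 * ?p2) + w2 * (?q1 * ?p1) = 0\<close> by linarith
    qed
  qed
  obtain b where b: "\<And>x. x \<ge> b \<Longrightarrow> poly ?Q x > 0" using charpoly_eventually_pos[OF fV] by blast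
  have QM: "poly ?Q M < 0" and Qm: "poly ?Q m < 0"
    using Qneg[OF mM(3)] Qneg[OF mM(1)] mid[of M] mid[of m] mM by auto
  have "M < b" using b[of M] QM by linarith
  then obtain L where L: "M < L" "poly ?Q L = 0"
    using poly_IVT_pos[of M b ?Q] QM b[of b] by auto
  have L2: "L > 2" using L mM by simp
  have above: "x = L" if "M < x" "poly ?Q x = 0" for x
  proof -
    have "g x = 1" "g L = 1" using Q0[of x] Q0[OF L2] that L mM by auto
    then show ?thesis using incr[of x L] incr[of L x] that L by (cases x L rule: linorder_cases) auto
  qed
  have below: "x < m" if "x > 2" "poly ?Q x = 0" "x \<noteq> L" for x
    using mid[of x] Q0[OF that(1)] above[of x] that by force
  have glim: "((\<lambda>x. ereal (g x)) \<longlongrightarrow> N) (at_right 2)"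
  proof -
    have sub: "((\<lambda>x. ereal (- f x)) \<longlongrightarrow> n - 2) (at_right 2)"
      if "((\<lambda>x. ereal (x - f x)) \<longlongrightarrow> n) (at_right 2)" "n > 2" for f :: "real \<Rightarrow> real" and n
    proof -
      have "((\<lambda>x::real. - x) \<longlongrightarrow> -2) (at_right 2)" by (intro tendsto_intros)
      then have "((\<lambda>x. ereal (- x)) \<longlongrightarrow> ereal (-2)) (at_right 2)" by simp
      then have "((\<lambda>x. ereal (x - f x) + ereal (- x)) \<longlongrightarrow> n + ereal (-2)) (at_right 2)"
        using that by (intro tendsto_add_ereal_nonneg) auto
      moreover have "n + ereal (-2) = n - 2" by (cases n) auto
      ultimately show ?thesis by simp
    qed
    \<comment> \<open>Both limits are positive, so the product rule also covers infinite
      \<nu>-values; this is why g is written as a product of -f1 and -f2.\<close>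
    have pos: "n - 2 > 0" if "n > 2" for n :: ereal using that by (cases n) auto
    have "((\<lambda>x. ereal (- f1 x) * ereal (- f2 x)) \<longlongrightarrow> N) (at_right 2)"
      unfolding N_def using nu by (intro tendsto_mult_ereal_pos sub lim1 lim2 pos)
    then show ?thesis by (simp add: g_def)
  qed
  have rle: "{x. x > 2 \<and> poly ?Q x = 0} = {L}" if "N \<le> 1"
  proof -
    have "x = L" if x: "x > 2" "poly ?Q x = 0" for x
    proof (rule ccontr)
      assume "x \<noteq> L"
      then have xm: "x < m" using below x by blast
      \<comment> \<open>Passing to the limit gives only weak inequalities. A point y strictly
        between 2 and x gives 1 = g x < g y \<le> N, a contradiction even when N = 1.\<close>
      define y where "y = (2 + x) / 2"
      have y: "2 < y" "y < x" using x by (auto simp: y_def)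
      have "\<forall>\<^sub>F z in at_right 2. z \<in> {2<..<y}" using y by (intro eventually_at_right_real)
      then have "\<forall>\<^sub>F z in at_right 2. ereal (g y) \<le> ereal (g z)"
        by eventually_elim (use decr[of _ y] y xm in \<open>auto intro: less_imp_le\<close>)
      then have "ereal (g y) \<le> N" by (rule tendsto_lowerbound[OF glim]) simp
      also have "N \<le> ereal 1" using \<open>N \<le> 1\<close> by (simp add: one_ereal_def)
      finally have "ereal (g y) \<le> ereal 1" .
      then show False using decr[OF y xm] Q0[OF x(1)] x by simp
    qed
    moreover have "L \<in> {x. x > 2 \<and> poly ?Q x = 0}" using L L2 by simp
    ultimately show ?thesis by blast
  qed
  have rgt: "\<exists>k. k \<noteq> L \<and> {x. x > 2 \<and> poly ?Q x = 0} = {k, L}" if "N > 1"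
  proof -
    have "\<forall>\<^sub>F z in at_right 2. ereal 1 < ereal (g z)"
      using that by (intro order_tendstoD(1)[OF glim]) (simp add: one_ereal_def)
    moreover have "\<forall>\<^sub>F z in at_right 2. z \<in> {2<..<m}" using mM by (intro eventually_at_right_real)
    ultimately have "\<forall>\<^sub>F z in at_right 2. 2 < z \<and> z < m \<and> g z > 1" by eventually_elim auto
    then obtain y where y: "2 < y" "y < m" "g y > 1"
      using eventually_happens'[of "at_right (2::real)"] by auto
    obtain k where k: "y < k" "k < m" "poly ?Q k = 0"
      using poly_IVT_neg[of y m ?Q] y Qm Qpos[OF y(1)] by auto
    have k2: "k > 2" using k y by simp
    have "x = k" if x: "x > 2" "poly ?Q x = 0" "x \<noteq> L" for x
    proof -
      have "g x = 1" "g k = 1" using Q0[OF x(1)] Q0[OF k2] x k by auto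
      then show ?thesis
        using decr[of x k] decr[of k x] below[OF x] k k2 x by (cases x k rule: linorder_cases) auto
    qed
    moreover have "k \<in> {x. x > 2 \<and> poly ?Q x = 0}" "L \<in> {x. x > 2 \<and> poly ?Q x = 0}"
      using k k2 L L2 by simp_all
    ultimately have "{x. x > 2 \<and> poly ?Q x = 0} = {k, L}" by blast
    moreover have "k \<noteq> L" using k L mM by auto
    ultimately show ?thesis by blast
  qed
  show ?thesis using that[OF L2 L(2) simple rle rgt] .
qed

text \<open>The third claim serves the converse: for a tree known to be Salem it turns the mere
  splitting along an edge into the bound on the product.\<close>

lemma edge_join:
  assumes "typeA A E1 r" "typeA B E2 s" "is_tree V E"
    and "charpoly V E = charpoly A E1 * charpoly B E2 - charpoly (A - {r}) E1 * charpoly (B - {s}) E2"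
  shows "(nu_forest A E1 r - 2) * (nu_forest B E2 s - 2) \<le> 1 \<Longrightarrow> salem_tree V E"
    and "(nu_forest A E1 r - 2) * (nu_forest B E2 s - 2) > 1 \<Longrightarrow> roots_outside (Rpoly V E) = 2"
    and "(nu_forest A E1 r - 2) * (nu_forest B E2 s - 2) > 1 \<Longrightarrow> \<not> salem_tree V E"
proof -
  let ?N = "(nu_forest A E1 r - 2) * (nu_forest B E2 s - 2)"
  let ?X = "{x. x > 2 \<and> poly (charpoly V E) x = 0}"
  have f: "forest V E" using assms(3) by (simp add: is_tree_iff_forest)
  obtain L where L: "L > 2" "poly (charpoly V E) L = 0"
    and simple: "\<And>x. x > 2 \<Longrightarrow> poly (charpoly V E) x = 0 \<Longrightarrow> poly (pderiv (charpoly V E)) x \<noteq> 0"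
    and le: "?N \<le> 1 \<Longrightarrow> ?X = {L}"
    and gt: "?N > 1 \<Longrightarrow> \<exists>k. k \<noteq> L \<and> ?X = {k, L}"
    by (rule edge_join_eigenvalues[OF assms]) blast
  show "salem_tree V E" if "?N \<le> 1"
    using le[OF that] by (intro salem_treeI[OF assms(3) L simple[OF L]]) blast
  show "roots_outside (Rpoly V E) = 2" if N: "?N > 1"
  proof -
    obtain k where "k \<noteq> L" "?X = {k, L}" using gt[OF N] by blast
    then show ?thesis using roots_outside_Rpoly[OF f simple] by simp
  qed
  show "\<not> salem_tree V E" if N: "?N > 1"
  proof
    assume "salem_tree V E"
    then obtain l where "\<And>x. x > 2 \<Longrightarrow> poly (charpoly V E) x = 0 \<Longrightarrow> x = l"
      unfolding salem_tree_def salem_graph_def is_eigenvalue_def by blast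
    then have sub: "?X \<subseteq> {l}" by blast
    obtain k where k: "k \<noteq> L" "?X = {k, L}" using gt[OF N] by blast
    show False using sub k(1) unfolding k(2) by blast
  qed
qed

section \<open>The tree obtained by joining two roots\<close>

lemma is_tree_plus:
  assumes t1: "is_tree A E1" and t2: "is_tree B E2" and r: "r \<in> A" and s: "s \<in> B" and dj: "A \<inter> B = {}"
  shows "is_tree (A \<union> B) (plus_rel A E1 r B E2 s)"
proof -
  let ?F = "plus_rel A E1 r B E2 s"
  have sg: "simple_graph A E1" "simple_graph B E2" and c: "conn A E1" "conn B E2"
    and e: "edge_count A E1 = 2 * (card A - 1)" "edge_count B E2 = 2 * (card B - 1)"
    using t1 t2 by (auto simp: is_tree_iff_edge_count)
  have fin: "finite A" "finite B" using sg by (auto simp: simple_graph_def)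
  have irr: "\<And>u. u \<in> A \<Longrightarrow> \<not> E1 u u" "\<And>u. u \<in> B \<Longrightarrow> \<not> E2 u u"
    and sym: "\<And>u v. u \<in> A \<Longrightarrow> v \<in> A \<Longrightarrow> E1 u v \<Longrightarrow> E1 v u"
      "\<And>u v. u \<in> B \<Longrightarrow> v \<in> B \<Longrightarrow> E2 u v \<Longrightarrow> E2 v u"
    using sg unfolding simple_graph_def by blast+
  have nrs: "r \<noteq> s" "r \<notin> B" "s \<notin> A" using r s dj by auto
  have sgF: "simple_graph (A \<union> B) ?F"
    unfolding simple_graph_def plus_rel_def adj_on_def using fin irr sym nrs by blast
  have adj: "adj_on (A \<union> B) ?F u v \<longleftrightarrow> adj_on A E1 u v \<or> adj_on B E2 u v \<or> (u = r \<and> v = s) \<or> (u = s \<and> v = r)"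
    for u v unfolding plus_rel_def adj_on_def using r s by blast
  have mono: "(adj_on (A \<union> B) ?F)\<^sup>*\<^sup>* u v" if "(adj_on A E1)\<^sup>*\<^sup>* u v \<or> (adj_on B E2)\<^sup>*\<^sup>* u v" for u v
  proof -
    have "adj_on A E1 \<le> adj_on (A \<union> B) ?F" "adj_on B E2 \<le> adj_on (A \<union> B) ?F"
      using adj by (auto simp: le_fun_def)
    then have "(adj_on A E1)\<^sup>*\<^sup>* \<le> (adj_on (A \<union> B) ?F)\<^sup>*\<^sup>*" "(adj_on B E2)\<^sup>*\<^sup>* \<le> (adj_on (A \<union> B) ?F)\<^sup>*\<^sup>*"
      by (simp_all add: rtranclp_mono)
    then show ?thesis using that by (auto simp: le_fun_def)
  qed
  have rs: "(adj_on (A \<union> B) ?F)\<^sup>*\<^sup>* r s" "(adj_on (A \<union> B) ?F)\<^sup>*\<^sup>* s r" using adj by auto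
  have to_r: "(adj_on (A \<union> B) ?F)\<^sup>*\<^sup>* u r \<and> (adj_on (A \<union> B) ?F)\<^sup>*\<^sup>* r u" if u: "u \<in> A \<union> B" for u
  proof (cases "u \<in> A")
    case True
    then show ?thesis using c(1) r mono unfolding conn_def by blast
  next
    case False
    then have "u \<in> B" using u by blast
    then have "(adj_on (A \<union> B) ?F)\<^sup>*\<^sup>* u s" "(adj_on (A \<union> B) ?F)\<^sup>*\<^sup>* s u"
      using c(2) s mono unfolding conn_def by blast+
    then show ?thesis using rs by (meson rtranclp_trans)
  qed
  have "conn (A \<union> B) ?F" unfolding conn_def using to_r by (meson rtranclp_trans)
  moreover have "edge_count (A \<union> B) ?F = 2 * (card (A \<union> B) - 1)"
  proof -
    let ?EA = "{(u, v). adj_on A E1 u v}" and ?EB = "{(u, v). adj_on B E2 u v}"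
    have "{(u, v). adj_on (A \<union> B) ?F u v} = (?EA \<union> ?EB) \<union> {(r, s), (s, r)}"
      by (auto simp: adj)
    moreover have "card ((?EA \<union> ?EB) \<union> {(r, s), (s, r)}) = card ?EA + card ?EB + 2"
    proof -
      have "card (?EA \<union> ?EB) = card ?EA + card ?EB"
        using dj fin by (intro card_Un_disjoint finite_edges) (auto simp: adj_on_def)
      moreover have "(?EA \<union> ?EB) \<inter> {(r, s), (s, r)} = {}" using nrs by (auto simp: adj_on_def)
      ultimately show ?thesis
        using nrs fin by (subst card_Un_disjoint) (auto simp: finite_edges)
    qed
    moreover have "card A > 0" "card B > 0" using fin r s by (auto simp: card_gt_0_iff)
    ultimately show ?thesis
      using e dj fin by (simp add: edge_count_def card_Un_disjoint)
  qed
  ultimately show ?thesis using sgF r by (auto simp: is_tree_iff_edge_count)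
qed

lemma charpoly_plus:
  assumes t1: "is_tree A E1" and t2: "is_tree B E2" and r: "r \<in> A" and s: "s \<in> B" and dj: "A \<inter> B = {}"
  shows "charpoly (A \<union> B) (plus_rel A E1 r B E2 s)
    = charpoly A E1 * charpoly B E2 - charpoly (A - {r}) E1 * charpoly (B - {s}) E2"
proof -
  let ?F = "plus_rel A E1 r B E2 s"
  have nrs: "r \<notin> B" "s \<notin> A" using r s dj by auto
  have cA: "charpoly U ?F = charpoly U E1" if "U \<subseteq> A" for U
    by (rule charpoly_cong) (use that dj nrs in \<open>auto simp: plus_rel_def adj_on_def\<close>)
  have cB: "charpoly U ?F = charpoly U E2" if "U \<subseteq> B" for U
    by (rule charpoly_cong) (use that dj nrs in \<open>auto simp: plus_rel_def adj_on_def\<close>)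
  have "charpoly (A \<union> B) ?F
      = charpoly A ?F * charpoly B ?F - charpoly (A - {r}) ?F * charpoly (B - {s}) ?F"
  proof (rule charpoly_Un_edge[OF _ dj r s])
    show "forest (A \<union> B) ?F" using is_tree_plus[OF assms] by (simp add: is_tree_iff_forest)
    show "a = r \<and> b = s" if "a \<in> A" "b \<in> B" "?F a b" for a b
      using that dj nrs by (auto simp: plus_rel_def adj_on_def)
  qed (simp add: plus_rel_def)
  then show ?thesis by (simp add: cA cB)
qed

section \<open>Cutting a tree at an edge\<close>

text \<open>Seen from r, the branch at c consists of c and of all branches at c except the one
  leading back to r. Hence it is strictly larger than each of these, disjoint from the branch back
  to r, and has exactly these as its own branches when rooted at c.\<close>

lemma edge_split:
  assumes t: "is_tree V E" and r: "r \<in> V" and c: "c \<in> root_children V E r"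
  shows "branch V E c r \<union> branch V E r c = V" "branch V E c r \<inter> branch V E r c = {}"
    and "\<And>u v. u \<in> branch V E c r \<Longrightarrow> v \<in> branch V E r c \<Longrightarrow> E u v \<Longrightarrow> u = r \<and> v = c"
    and "\<And>d. d \<in> root_children V E c \<Longrightarrow> d \<noteq> r \<Longrightarrow> branch V E c d \<subset> branch V E r c"
    and "\<And>d. d \<in> root_children (branch V E r c) E c \<Longrightarrow>
      d \<in> root_children V E c \<and> d \<noteq> r \<and> branch (branch V E r c) E c d = branch V E c d"
proof -
  have f: "forest V E" using t by (simp add: is_tree_iff_forest)
  note c' = root_childrenD[OF f r c]
  have rc: "r \<in> root_children V E c" using r c' by (simp add: root_children_def)
  let ?T1 = "branch V E c r" and ?T2 = "branch V E r c"
  let ?D = "root_children V E c - {r}"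
  have T1V: "?T1 \<subseteq> V - {c}" by (rule branch_subset[OF f c'(1) rc])
  have T2V: "?T2 \<subseteq> V - {r}" by (rule branch_subset[OF f r c])
  have D: "branch V E c d \<inter> ?T1 = {}" if "d \<in> ?D" for d
    using branch_disjoint[OF f c'(1) _ rc, of d] that by blast
  have DV: "branch V E c d \<subseteq> V - {c}" if "d \<in> ?D" for d
    using branch_subset[OF f c'(1)] that by blast
  have sub: "branch V E c d \<subset> ?T2" if d: "d \<in> root_children V E c" "d \<noteq> r" for d
  proof -
    have rd: "r \<notin> branch V E c d" using D[of d] d in_branch[of r V E c] by blast
    have "branch V E c d \<subseteq> branch V E c d \<inter> ?T2"
      unfolding branch_eq_reach[of V E c]
    proof (rule reach_least)
      have "d \<in> V - {r}" using d by (auto simp: root_children_def)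
      then show "d \<in> reach (V - {c}) E d \<inter> ?T2"
        using reach_closed[of c "V - {r}" E c d] c' d
        by (auto simp: branch_eq_reach root_children_def)
    next
      fix u v assume uv: "u \<in> reach (V - {c}) E d \<inter> ?T2" "u \<in> V - {c}" "v \<in> V - {c}" "E u v"
      then have v: "v \<in> reach (V - {c}) E d" using reach_closed[of u "V - {c}" E d v] by blast
      then have "v \<noteq> r" using rd by (auto simp: branch_eq_reach)
      moreover have "u \<noteq> r" using uv rd by (auto simp: branch_eq_reach)
      ultimately show "v \<in> reach (V - {c}) E d \<inter> ?T2"
        using uv v reach_closed[of u "V - {r}" E c v] by (auto simp: branch_eq_reach)
    qed
    moreover have "c \<notin> branch V E c d" using DV[of d] d by blast
    ultimately show ?thesis using in_branch[of c V E r] by blast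
  qed
  then show "\<And>d. d \<in> root_children V E c \<Longrightarrow> d \<noteq> r \<Longrightarrow> branch V E c d \<subset> ?T2" .
  let ?X = "insert c (\<Union>d\<in>?D. branch V E c d)"
  have "?T2 \<subseteq> ?X"
    unfolding branch_eq_reach[of V E r]
  proof (rule reach_least)
    fix u v assume uv: "u \<in> ?X" "u \<in> V - {r}" "v \<in> V - {r}" "E u v"
    show "v \<in> ?X"
    proof (cases "u = c \<or> v = c")
      case True
      then have "v = c \<or> v \<in> ?D" using uv by (auto simp: root_children_def)
      then show ?thesis using in_branch[of v V E c] by blast
    next
      case False
      then obtain d where "d \<in> ?D" "u \<in> branch V E c d" using uv by blast
      then show ?thesis
        using False uv reach_closed[of u "V - {c}" E d v] by (auto simp: branch_eq_reach)
    qed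
  qed simp
  then have T2X: "?T2 = ?X" using sub in_branch[of c V E r] by blast
  show dj: "?T1 \<inter> ?T2 = {}" unfolding T2X using D T1V by blast
  have "root_children V E c = insert r ?D" using rc by blast
  then have "V - {c} = ?T1 \<union> (\<Union>d\<in>?D. branch V E c d)"
    using UN_branch[OF t c'(1)] by (metis UN_insert)
  then show "?T1 \<union> ?T2 = V" unfolding T2X using c'(1) by blast
  show "u = r \<and> v = c" if uv: "u \<in> ?T1" "v \<in> ?T2" "E u v" for u v
  proof (rule ccontr)
    assume n: "\<not> (u = r \<and> v = c)"
    have V: "u \<in> V - {c}" "v \<in> V - {r}" using uv T1V T2V by blast+
    have "E v u" using forest_sym[OF f _ _ uv(3)] V by blast
    show False
    proof (cases "v = c")
      case True
      then have "u \<in> ?T2"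
        using n V uv \<open>E v u\<close> reach_closed[of v "V - {r}" E c u] by (auto simp: branch_eq_reach)
      then show False using dj uv by blast
    next
      case False
      then have "v \<in> ?T1"
        using V uv reach_closed[of u "V - {c}" E r v] by (auto simp: branch_eq_reach)
      then show False using dj uv by blast
    qed
  qed
  show "d \<in> root_children V E c \<and> d \<noteq> r \<and> branch ?T2 E c d = branch V E c d"
    if d: "d \<in> root_children ?T2 E c" for d
  proof -
    have dV: "d \<in> root_children V E c" "d \<noteq> r" using d T2V by (auto simp: root_children_def)
    have "reach (?T2 - {c}) E d = reach (V - {c}) E d"
    proof (rule reach_restrict)
      show "?T2 - {c} \<subseteq> V - {c}" using T2V by blast
      show "reach (V - {c}) E d \<subseteq> ?T2 - {c}"
        using sub[OF dV] DV[of d] dV by (auto simp: branch_eq_reach)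
    qed
    then show ?thesis using dV by (simp add: branch_eq_reach[of _ E c])
  qed
qed

text \<open>A vertex \<open>c\<close> reached through a smallest non-cyclotomic branch serves as the root, unless the
  branch back through its parent \<open>r\<close> is not cyclotomic either; then the edge from \<open>r\<close> to \<open>c\<close>
  splits the tree as in (b).\<close>

lemma salem_tree_decomposition:
  assumes S: "salem_tree V E"
  shows "(\<exists>r. typeA V E r) \<or> (\<exists>V1 r1 V2 r2. typeA V1 E r1 \<and> typeA V2 E r2 \<and> V1 \<inter> V2 = {}
    \<and> (nu_forest V1 E r1 - 2) * (nu_forest V2 E r2 - 2) \<le> 1 \<and> V = V1 \<union> V2
    \<and> (\<forall>u\<in>V. \<forall>v\<in>V. E u v \<longleftrightarrow> plus_rel V1 E r1 V2 E r2 u v))"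
proof -
  have t: "is_tree V E" using S by (simp add: salem_tree_def)
  then have f: "forest V E" and ne: "V \<noteq> {}" by (auto simp: is_tree_iff_forest)
  obtain l where l: "l > 2" "poly (charpoly V E) l = 0"
    and uniq: "\<And>x. x > 2 \<Longrightarrow> poly (charpoly V E) x = 0 \<Longrightarrow> x = l"
    using S unfolding salem_tree_def salem_graph_def is_eigenvalue_def by blast
  have ncV: "\<not> pos_above V E 2" using l by (auto simp: pos_above_def)
  define bad where "bad p \<longleftrightarrow> fst p \<in> V \<and> snd p \<in> root_children V E (fst p)
    \<and> \<not> pos_above (branch V E (fst p) (snd p)) E 2" for p
  show ?thesis
  proof (cases "\<exists>r\<in>V. \<forall>c\<in>root_children V E r. pos_above (branch V E r c) E 2")
    case True
    then show ?thesis using typeA_of_noncyclotomic[OF t _ _ ncV] by blast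
  next
    case False
    then obtain p0 where "bad p0" using ne unfolding bad_def by fastforce
    then obtain p where p: "bad p"
      and min: "\<And>q. bad q \<Longrightarrow> card (branch V E (fst p) (snd p)) \<le> card (branch V E (fst q) (snd q))"
      using ex_has_least_nat[of bad p0 "\<lambda>p. card (branch V E (fst p) (snd p))"] by blast
    obtain r c where rc: "p = (r, c)" by (cases p)
    have r: "r \<in> V" and c: "c \<in> root_children V E r" and nc: "\<not> pos_above (branch V E r c) E 2"
      using p by (auto simp: bad_def rc)
    let ?T1 = "branch V E c r" and ?T2 = "branch V E r c"
    note c' = root_childrenD[OF f r c]
    have rN: "r \<in> root_children V E c" using r c' by (simp add: root_children_def)
    note sp = edge_split[OF t r c] and sp' = edge_split[OF t c'(1) rN]
    have fin: "finite ?T2" using is_tree_branch[OF f r c] by (simp add: is_tree_def)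
    have small: "pos_above (branch V E c d) E 2" if d: "d \<in> root_children V E c" "d \<noteq> r" for d
    proof (rule ccontr)
      assume "\<not> ?thesis"
      then have "bad (c, d)" using d c' by (simp add: bad_def)
      then have "card ?T2 \<le> card (branch V E c d)" using min[of "(c, d)"] by (simp add: rc)
      then show False using psubset_card_mono[OF fin sp(4)[OF d]] by simp
    qed
    \<comment> \<open>As c is no root for (a), some branch at c is not cyclotomic. The branches
      leading away from r are smaller than the chosen minimum, so it is the one back to r.\<close>
    have ncT1: "\<not> pos_above ?T1 E 2"
      using False small c'(1) by blast
    \<comment> \<open>At r minimality says nothing; here the uniqueness of the eigenvalue above 2
      leaves c as the only bad child.\<close>
    have other: "pos_above (branch V E r d) E 2" if "d \<in> root_children V E r" "d \<noteq> c" for d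
      using at_most_one_noncyclotomic_branch[OF t r c that(1) that(2)[symmetric] l uniq nc] .
    have t1: "is_tree ?T1 E" and t2: "is_tree ?T2 E"
      using is_tree_branch[OF f r c] is_tree_branch[OF f c'(1) rN] by auto
    have A1: "typeA ?T1 E r"
      by (rule typeA_of_noncyclotomic[OF t1 in_branch _ ncT1]) (use sp'(5) other in force)
    have A2: "typeA ?T2 E c"
      by (rule typeA_of_noncyclotomic[OF t2 in_branch _ nc]) (use sp(5) small in force)
    have "charpoly V E = charpoly ?T1 E * charpoly ?T2 E - charpoly (?T1 - {r}) E * charpoly (?T2 - {c}) E"
      using charpoly_Un_edge[of ?T1 ?T2 E r c] f sp(1-3) c' by simp
    \<comment> \<open>A product above 1 would produce two eigenvalues above 2.\<close>
    then have N: "(nu_forest ?T1 E r - 2) * (nu_forest ?T2 E c - 2) \<le> 1"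
      using edge_join(3)[OF A1 A2 t] S by (meson not_le)
    have "E u v \<longleftrightarrow> plus_rel ?T1 E r ?T2 E c u v" if "u \<in> V" "v \<in> V" for u v
    proof -
      have uv: "u \<in> ?T1 \<or> u \<in> ?T2" "v \<in> ?T1 \<or> v \<in> ?T2" using that sp(1) by blast+
      show ?thesis
        unfolding plus_rel_def adj_on_def
        using uv sp(3)[of u v] sp(3)[of v u] forest_sym[OF f that] c'(3,4) by blast
    qed
    then show ?thesis using A1 A2 N sp(1,2) by blast
  qed
qed

theorem theorem16:
  shows
  "(\<forall>(V :: 'a set) E r. is_tree V E \<and> r \<in> V
      \<and> (\<forall>c\<in>root_children V E r. cyclotomic_tree (branch V E r c) E) \<longrightarrow>
      (nu_forest V E r > 2 \<longrightarrow> salem_tree V E)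
      \<and> (nu_forest V E r \<le> 2 \<longrightarrow> cyclotomic_tree V E))
   \<and> (\<forall>(V1 :: 'a set) E1 r1 V2 E2 r2. typeA V1 E1 r1 \<and> typeA V2 E2 r2 \<and> V1 \<inter> V2 = {} \<longrightarrow>
      ((nu_forest V1 E1 r1 - 2) * (nu_forest V2 E2 r2 - 2) \<le> 1
          \<longrightarrow> salem_tree (V1 \<union> V2) (plus_rel V1 E1 r1 V2 E2 r2))
      \<and> ((nu_forest V1 E1 r1 - 2) * (nu_forest V2 E2 r2 - 2) > 1
          \<longrightarrow> roots_outside (Rpoly (V1 \<union> V2) (plus_rel V1 E1 r1 V2 E2 r2)) = 2))
   \<and> (\<forall>(V :: 'a set) E. salem_tree V E \<longrightarrow>
      (\<exists>r. typeA V E r)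
      \<or> (\<exists>V1 E1 r1 V2 E2 r2. typeA V1 E1 r1 \<and> typeA V2 E2 r2 \<and> V1 \<inter> V2 = {}
           \<and> (nu_forest V1 E1 r1 - 2) * (nu_forest V2 E2 r2 - 2) \<le> 1
           \<and> V = V1 \<union> V2
           \<and> (\<forall>u\<in>V. \<forall>v\<in>V. E u v \<longleftrightarrow> plus_rel V1 E1 r1 V2 E2 r2 u v)))"
proof (intro conjI allI impI)
  fix V :: "'a set" and E r
  assume a: "is_tree V E \<and> r \<in> V \<and> (\<forall>c\<in>root_children V E r. cyclotomic_tree (branch V E r c) E)"
  then have f: "forest V E" by (simp add: is_tree_iff_forest)
  show "salem_tree V E" if "nu_forest V E r > 2"
    by (rule typeA_salem_tree[of V E r]) (use a that in \<open>simp add: typeA_def\<close>)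
  show "cyclotomic_tree V E" if "nu_forest V E r \<le> 2"
    using pos_above_of_nu_forest_le[of V E r] a that cyclotomic_branches_iff_pos_above[of V E r]
      cyclotomic_iff_pos_above[OF f] by (auto simp: cyclotomic_tree_def)
next
  fix V1 V2 :: "'a set" and E1 r1 E2 r2
  assume a: "typeA V1 E1 r1 \<and> typeA V2 E2 r2 \<and> V1 \<inter> V2 = {}"
  then have t: "is_tree V1 E1" "is_tree V2 E2" "r1 \<in> V1" "r2 \<in> V2" "V1 \<inter> V2 = {}"
    by (auto simp: typeA_def)
  note j = edge_join[OF _ _ is_tree_plus[OF t] charpoly_plus[OF t]]
  show "salem_tree (V1 \<union> V2) (plus_rel V1 E1 r1 V2 E2 r2)"
    if "(nu_forest V1 E1 r1 - 2) * (nu_forest V2 E2 r2 - 2) \<le> 1"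
    using j(1) a that by blast
  show "roots_outside (Rpoly (V1 \<union> V2) (plus_rel V1 E1 r1 V2 E2 r2)) = 2"
    if "(nu_forest V1 E1 r1 - 2) * (nu_forest V2 E2 r2 - 2) > 1"
    using j(2) a that by blast
next
  fix V :: "'a set" and E
  assume "salem_tree V E"
  from salem_tree_decomposition[OF this]
  show "(\<exists>r. typeA V E r)
      \<or> (\<exists>V1 E1 r1 V2 E2 r2. typeA V1 E1 r1 \<and> typeA V2 E2 r2 \<and> V1 \<inter> V2 = {}
           \<and> (nu_forest V1 E1 r1 - 2) * (nu_forest V2 E2 r2 - 2) \<le> 1
           \<and> V = V1 \<union> V2
           \<and> (\<forall>u\<in>V. \<forall>v\<in>V. E u v \<longleftrightarrow> plus_rel V1 E1 r1 V2 E2 r2 u v))"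
    by blast
qed

end
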